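(* Let $L$ be a number field, let $A\le B$ be integers, write $D=B-A$ and $M=\max\{|A|,|B|\}$. Let $F\in L[X]$ be a polynomial of degree at most $d\geq 1$, let $N\geq d+1$ be an integer, let $H$ be a real number, and let $x_1,\ldots,x_N$ be distinct elements of $\{x\in\mathbb{Z}: A\le x\le B\}$. Assume that $h(F(x_i))\leq H$ for every $1\leq i\leq N$. Then \[ h(F) \leq \frac{N}{N-d}\, H + D\log(D) + d\log(2M) + \log(d+1). \]
   Context: For a number field $L$ of degree $d_L$ over $\mathbb{Q}$ and a place $v$ of $L$, $d_v=[L_v:\mathbb{Q}_v]$ denotes the local degree, and $|\cdot|_v$ denotes the absolute value on $L$ extending the usual absolute value of $\mathbb{Q}$ if $v$ is archimedean, and satisfying $|p|_v=1/p$ if $v$ is nonarchimedean lying over the prime $p$. The (absolute logarithmic Weil) height of $a\in L$ is $h(a)=\sum_{v}\frac{d_v}{d_L}\log\max\{1,|a|_v\}$, the sum over all places of $L$. For $P=\sum_i a_iX^i\in L[X]$, set $|P|_v=\max_i|a_i|_v$ and $h(P)=\sum_v\frac{d_v}{d_L}\log\max\{1,|P|_v\}$. *)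

theory Defs
  imports "HOL-Analysis.Analysis" "HOL-Algebra.QuotRing" "HOL-Algebra.Embedded_Algebras"
begin

definition number_field :: "'a::field_char_0 itself \<Rightarrow> bool" where
  "number_field _ \<longleftrightarrow>
     (\<exists>B. finite B \<and> module.span (\<lambda>(q::rat) (x::'a). of_rat q * x) B = UNIV)"

definition field_degree :: "'a::field_char_0 itself \<Rightarrow> nat" where
  "field_degree _ = vector_space.dim (\<lambda>(q::rat) (x::'a). of_rat q * x) UNIV"

definition absolute_value :: "('a::field \<Rightarrow> real) \<Rightarrow> bool" where
  "absolute_value v \<longleftrightarrow>
     (\<forall>x. 0 \<le> v x) \<and> (\<forall>x. v x = 0 \<longleftrightarrow> x = 0) \<and>
     (\<forall>x y. v (x * y) = v x * v y) \<and> (\<forall>x y. v (x + y) \<le> v x + v y)"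

text \<open>
  A place is represented by the unique absolute value in its class with the standard
  normalisation: it extends the usual absolute value of the rationals, or it is
  nonarchimedean and takes the value \<open>1/p\<close> at a prime \<open>p\<close>.
\<close>

definition archimedean_place :: "('a::field_char_0 \<Rightarrow> real) \<Rightarrow> bool" where
  "archimedean_place v \<longleftrightarrow> absolute_value v \<and> (\<forall>q::rat. v (of_rat q) = real_of_rat \<bar>q\<bar>)"

definition nonarchimedean_place_over :: "nat \<Rightarrow> ('a::field_char_0 \<Rightarrow> real) \<Rightarrow> bool" where
  "nonarchimedean_place_over p v \<longleftrightarrow>
     absolute_value v \<and> (\<forall>x y. v (x + y) \<le> max (v x) (v y)) \<and> v (of_nat p) = 1 / real p"

definition places :: "('a::field_char_0 \<Rightarrow> real) set" where
  "places = {v. archimedean_place v \<or> (\<exists>p::nat. Factorial_Ring.prime p \<and> nonarchimedean_place_over p v)}"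

text \<open>
  The completion of the field at \<open>v\<close>: Cauchy sequences with respect to \<open>v\<close> modulo null sequences.
\<close>

definition cauchy_wrt :: "('a::field \<Rightarrow> real) \<Rightarrow> (nat \<Rightarrow> 'a) \<Rightarrow> bool" where
  "cauchy_wrt v s \<longleftrightarrow> (\<forall>\<epsilon>>0. \<exists>K. \<forall>m\<ge>K. \<forall>n\<ge>K. v (s m - s n) < \<epsilon>)"

definition cauchy_ring :: "('a::field \<Rightarrow> real) \<Rightarrow> (nat \<Rightarrow> 'a) ring" where
  "cauchy_ring v =
     \<lparr>carrier = {s. cauchy_wrt v s}, mult = (\<lambda>s t n. s n * t n), one = (\<lambda>n. 1),
      ring.zero = (\<lambda>n. 0), ring.add = (\<lambda>s t n. s n + t n)\<rparr>"

definition null_sequences :: "('a::field \<Rightarrow> real) \<Rightarrow> (nat \<Rightarrow> 'a) set" where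
  "null_sequences v = {s. (\<lambda>n. v (s n)) \<longlonglongrightarrow> 0}"

definition completion :: "('a::field \<Rightarrow> real) \<Rightarrow> (nat \<Rightarrow> 'a) set ring" where
  "completion v = cauchy_ring v Quot null_sequences v"

text \<open>
  The completion of the rationals at the restriction of \<open>v\<close>, in its canonical embedding into the
  completion at \<open>v\<close>: the classes of Cauchy sequences of rationals.
\<close>

definition rat_completion :: "('a::field_char_0 \<Rightarrow> real) \<Rightarrow> (nat \<Rightarrow> 'a) set set" where
  "rat_completion v =
     {null_sequences v +>\<^bsub>cauchy_ring v\<^esub> s | s. cauchy_wrt v s \<and> range s \<subseteq> \<rat>}"

definition local_degree :: "('a::field_char_0 \<Rightarrow> real) \<Rightarrow> nat" where
  "local_degree v = ring.dim (completion v) (rat_completion v) (carrier (completion v))"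

definition height :: "'a::field_char_0 \<Rightarrow> real" where
  "height a = (\<Sum>\<^sub>\<infinity>v\<in>places.
     real (local_degree v) / real (field_degree TYPE('a)) * ln (max 1 (v a)))"

definition poly_abs :: "('a::field_char_0 \<Rightarrow> real) \<Rightarrow> 'a poly \<Rightarrow> real" where
  "poly_abs v P = Max ((\<lambda>i. v (poly.coeff P i)) ` {..Polynomial.degree P})"

definition poly_height :: "'a::field_char_0 poly \<Rightarrow> real" where
  "poly_height P = (\<Sum>\<^sub>\<infinity>v\<in>places.
     real (local_degree v) / real (field_degree TYPE('a)) * ln (max 1 (poly_abs v P)))"

end

theory Submission
  imports Defs
begin

text \<open>
  At a place \<open>v\<close>, put \<open>t = (\<Sum>i. log max {1, |F(x\<^sub>i)|\<^sub>v}) / (N - d)\<close>. Fewer than \<open>N - d\<close> of the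
  summands exceed \<open>t\<close>, so Lagrange interpolation at \<open>d + 1\<close> of the remaining points bounds
  \<open>log |F|\<^sub>v\<close> by \<open>t\<close> plus an error, which is \<open>log ((d + 1) (2 M)\<^sup>d)\<close> if \<open>v\<close> is archimedean and
  \<open>- log |D!|\<^sub>v\<close> otherwise, because the denominators divide \<open>D!\<close>. Summing over the places gives the
  claim once the local degrees above each place of the rationals add up to at most the degree of
  the field. Only this inequality is needed: by weak approximation, bases of the
  completions can be perturbed to elements of the field which are linearly independent over the
  rationals.
\<close>

section \<open>Absolute values and completions\<close>

text \<open>The completion is only a ring of classes of sequences, and its dimension over the
  rational completion is not known in advance to be finite. Independence there is therefore turned
  into a lower bound at one fixed index, uniform in the rational coefficients: a statement about
  elements of the field that survives small perturbations. Applied at one place it bounds all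
  independent lists and so makes \<open>local_degree\<close> a genuine dimension; applied at several
  places at once it bounds the sum of the local degrees. An inequality for this sum suffices since
  the local errors are nonnegative. The archimedean error comes from d + 1 interpolation terms, each
  with a product of d linear factors whose coefficients are at most (1 + M)^d \<le> (2 M)^d. The
  other errors sum to at most log D! \<le> D log D, by the corresponding half of the product
  formula. The heights are values of \<open>infsum\<close>, which is 0 where summability fails, so
  summability has to be carried along with the estimates.\<close>

lemma absolute_value_ge_0: "absolute_value v \<Longrightarrow> 0 \<le> v x"
  and absolute_value_eq_0: "absolute_value v \<Longrightarrow> v x = 0 \<longleftrightarrow> x = 0"
  and absolute_value_mult: "absolute_value v \<Longrightarrow> v (x * y) = v x * v y"
  and absolute_value_add: "absolute_value v \<Longrightarrow> v (x + y) \<le> v x + v y"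
  by (simp_all add: absolute_value_def)

locale valued_field =
  fixes v :: "'a::field_char_0 \<Rightarrow> real"
  assumes absolute_value: "absolute_value v"
begin

lemmas ge_0 [simp] = absolute_value_ge_0[OF absolute_value]
lemmas eq_0 [simp] = absolute_value_eq_0[OF absolute_value]
lemmas mult = absolute_value_mult[OF absolute_value]
lemmas add_le = absolute_value_add[OF absolute_value]

lemma zero [simp]: "v 0 = 0"
  by simp

lemma pos_iff [simp]: "v x > 0 \<longleftrightarrow> x \<noteq> 0"
  using ge_0[of x] eq_0[of x] by linarith

lemma one [simp]: "v 1 = 1"
  using mult[of 1 1] eq_0[of 1] by simp

lemma minus [simp]: "v (- x) = v x"
proof -
  have "v (- 1) * v (- 1) = 1"
    using mult[of "- 1" "- 1"] by simp
  then have "v (- 1) = 1"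
    using ge_0[of "- 1"] by (metis abs_of_nonneg abs_square_eq_1 power2_eq_square)
  then show ?thesis
    using mult[of "- 1" x] by simp
qed

lemma minus_commute: "v (x - y) = v (y - x)"
  using minus[of "x - y"] by simp

lemma diff_le: "v (x - y) \<le> v x + v y"
  using add_le[of x "- y"] by simp

lemma le_add_diff: "v x \<le> v y + v (x - y)"
  using add_le[of y "x - y"] by simp

lemma power: "v (x ^ n) = v x ^ n"
  by (induction n) (simp_all add: mult)

lemma inverse: "v (inverse x) = inverse (v x)"
proof (cases "x = 0")
  case False
  then have "v x * v (inverse x) = 1"
    using mult[of x "inverse x"] by simp
  then show ?thesis
    by (simp add: inverse_unique)
qed simp

lemma divide: "v (x / y) = v x / v y"
  by (simp add: divide_inverse mult inverse)

lemma sum_le: "v (sum f S) \<le> (\<Sum>i\<in>S. v (f i))"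
proof (induction S rule: infinite_finite_induct)
  case (insert i S)
  then show ?case
    using add_le[of "f i" "sum f S"] by simp
qed simp_all

section \<open>Cauchy sequences and null sequences\<close>

lemma cauchy_wrt_bounded:
  assumes "cauchy_wrt v s"
  obtains T where "T > 0" "\<And>n. v (s n) \<le> T"
proof -
  obtain K where K: "\<And>m n. m \<ge> K \<Longrightarrow> n \<ge> K \<Longrightarrow> v (s m - s n) < 1"
    using assms unfolding cauchy_wrt_def by (metis zero_less_one)
  define T where "T = 1 + (\<Sum>i\<le>K. v (s i))"
  have le: "v (s i) \<le> (\<Sum>i\<le>K. v (s i))" if "i \<le> K" for i
    by (rule member_le_sum) (use that in auto)
  have "v (s n) \<le> T" for n
  proof (cases "n \<le> K")
    case True
    then show ?thesis
      using le[OF True] by (simp add: T_def)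
  next
    case False
    then show ?thesis
      using le[of K] K[of n K] le_add_diff[of "s n" "s K"] by (simp add: T_def)
  qed
  moreover have "T > 0"
    using sum_nonneg[of "{..K}" "\<lambda>i. v (s i)"] by (simp add: T_def)
  ultimately show thesis
    using that by blast
qed

lemma cauchy_wrt_const: "cauchy_wrt v (\<lambda>n. a)"
  by (auto simp: cauchy_wrt_def)

lemma cauchy_wrt_add:
  assumes "cauchy_wrt v s" "cauchy_wrt v t"
  shows "cauchy_wrt v (\<lambda>n. s n + t n)"
  unfolding cauchy_wrt_def
proof (intro allI impI)
  fix e :: real assume "e > 0"
  then have "e / 2 > 0" by simp
  then obtain K1 K2 where
    "\<And>m n. m \<ge> K1 \<Longrightarrow> n \<ge> K1 \<Longrightarrow> v (s m - s n) < e / 2"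
    "\<And>m n. m \<ge> K2 \<Longrightarrow> n \<ge> K2 \<Longrightarrow> v (t m - t n) < e / 2"
    using assms unfolding cauchy_wrt_def by metis
  moreover have "v (s m + t m - (s n + t n)) \<le> v (s m - s n) + v (t m - t n)" for m n
    using add_le[of "s m - s n" "t m - t n"] by (simp add: algebra_simps)
  ultimately show "\<exists>K. \<forall>m\<ge>K. \<forall>n\<ge>K. v (s m + t m - (s n + t n)) < e"
    by (intro exI[of _ "max K1 K2"]) (smt (verit) field_sum_of_halves max.boundedE)
qed

lemma cauchy_wrt_uminus: "cauchy_wrt v s \<Longrightarrow> cauchy_wrt v (\<lambda>n. - s n)"
  by (simp add: cauchy_wrt_def) (metis minus_commute)

lemma cauchy_wrt_mult:
  assumes "cauchy_wrt v s" "cauchy_wrt v t"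
  shows "cauchy_wrt v (\<lambda>n. s n * t n)"
  unfolding cauchy_wrt_def
proof (intro allI impI)
  fix e :: real assume "e > 0"
  obtain S where S: "S > 0" "\<And>n. v (s n) \<le> S"
    using cauchy_wrt_bounded[OF assms(1)] by metis
  obtain T where T: "T > 0" "\<And>n. v (t n) \<le> T"
    using cauchy_wrt_bounded[OF assms(2)] by metis
  have "e / (2 * T) > 0" "e / (2 * S) > 0"
    using \<open>e > 0\<close> S T by simp_all
  then obtain K1 K2 where K:
    "\<And>m n. m \<ge> K1 \<Longrightarrow> n \<ge> K1 \<Longrightarrow> v (s m - s n) < e / (2 * T)"
    "\<And>m n. m \<ge> K2 \<Longrightarrow> n \<ge> K2 \<Longrightarrow> v (t m - t n) < e / (2 * S)"
    using assms unfolding cauchy_wrt_def by metis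
  have "v (s m * t m - s n * t n) < e" if "m \<ge> max K1 K2" "n \<ge> max K1 K2" for m n
  proof -
    have "v (s m * t m - s n * t n) \<le> v ((s m - s n) * t m) + v (s n * (t m - t n))"
      using add_le[of "(s m - s n) * t m" "s n * (t m - t n)"] by (simp add: algebra_simps)
    also have "\<dots> = v (s m - s n) * v (t m) + v (s n) * v (t m - t n)"
      by (simp add: mult)
    also have "\<dots> \<le> v (s m - s n) * T + S * v (t m - t n)"
      using S T by (intro add_mono mult_left_mono mult_right_mono) auto
    also have "\<dots> < e / (2 * T) * T + S * (e / (2 * S))"
      using K that S T by (intro add_strict_mono mult_strict_right_mono mult_strict_left_mono) auto
    also have "\<dots> = e"
      using S T by simp
    finally show ?thesis .
  qed
  then show "\<exists>K. \<forall>m\<ge>K. \<forall>n\<ge>K. v (s m * t m - s n * t n) < e"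
    by blast
qed

lemma null_sequences_iff: "s \<in> null_sequences v \<longleftrightarrow> (\<forall>e>0. \<exists>K. \<forall>n\<ge>K. v (s n) < e)"
  by (simp add: null_sequences_def LIMSEQ_iff)

lemma null_sequences_cauchy:
  assumes "s \<in> null_sequences v"
  shows "cauchy_wrt v s"
  unfolding cauchy_wrt_def
proof (intro allI impI)
  fix e :: real assume "e > 0"
  then obtain K where "\<And>n. n \<ge> K \<Longrightarrow> v (s n) < e / 2"
    using assms unfolding null_sequences_iff by (metis half_gt_zero)
  then show "\<exists>K. \<forall>m\<ge>K. \<forall>n\<ge>K. v (s m - s n) < e"
    by (intro exI[of _ K]) (smt (verit) diff_le field_sum_of_halves)
qed

lemma cauchy_wrt_bounded_below:
  assumes s: "cauchy_wrt v s" and "s \<notin> null_sequences v"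
  obtains c K where "c > 0" "\<And>n. n \<ge> K \<Longrightarrow> v (s n) \<ge> c"
proof -
  obtain e where e: "e > 0" "\<And>K. \<exists>n\<ge>K. v (s n) \<ge> e"
    using assms(2) unfolding null_sequences_iff by (metis not_less)
  obtain K where K: "\<And>m n. m \<ge> K \<Longrightarrow> n \<ge> K \<Longrightarrow> v (s m - s n) < e / 2"
    using s e(1) unfolding cauchy_wrt_def by (metis half_gt_zero)
  have "v (s n) \<ge> e / 2" if "n \<ge> K" for n
  proof -
    obtain m where "m \<ge> K" "v (s m) \<ge> e"
      using e(2) by blast
    then show ?thesis
      using K[OF _ that] le_add_diff[of "s m" "s n"] by fastforce
  qed
  then show thesis
    using that e(1) half_gt_zero by blast
qed

text \<open>From some index on the values of \<open>s\<close> stay above a positive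
  \<open>c\<close>. Earlier terms may be 0, with \<open>inverse 0 = 0\<close>, but the Cauchy
  condition only sees the tail.\<close>

lemma cauchy_wrt_inverse:
  assumes s: "cauchy_wrt v s" and "s \<notin> null_sequences v"
  shows "cauchy_wrt v (\<lambda>n. inverse (s n))"
  unfolding cauchy_wrt_def
proof (intro allI impI)
  fix e :: real assume "e > 0"
  obtain c K where c: "c > 0" "\<And>n. n \<ge> K \<Longrightarrow> v (s n) \<ge> c"
    using cauchy_wrt_bounded_below[OF assms] by metis
  have "e * c\<^sup>2 > 0"
    using \<open>e > 0\<close> c by simp
  then obtain K' where K': "\<And>m n. m \<ge> K' \<Longrightarrow> n \<ge> K' \<Longrightarrow> v (s m - s n) < e * c\<^sup>2"
    using s unfolding cauchy_wrt_def by metis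
  have "v (inverse (s m) - inverse (s n)) < e" if "m \<ge> max K K'" "n \<ge> max K K'" for m n
  proof -
    have ge: "v (s m) \<ge> c" "v (s n) \<ge> c"
      using c(2) that by simp_all
    then have nz: "s m \<noteq> 0" "s n \<noteq> 0"
      using c(1) by auto
    have "c\<^sup>2 \<le> v (s m) * v (s n)"
      unfolding power2_eq_square using ge c(1) by (intro mult_mono) auto
    then have "e * c\<^sup>2 \<le> e * (v (s m) * v (s n))"
      using \<open>e > 0\<close> by simp
    then have "v (s n - s m) < e * (v (s m) * v (s n))"
      using K'[of n m] that by simp
    moreover have "inverse (s m) - inverse (s n) = (s n - s m) / (s m * s n)"
      using nz by (simp add: field_simps)
    ultimately show ?thesis
      using nz by (simp add: divide mult pos_divide_less_eq)
  qed
  then show "\<exists>K. \<forall>m\<ge>K. \<forall>n\<ge>K. v (inverse (s m) - inverse (s n)) < e"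
    by blast
qed

lemma null_sequences_mult:
  assumes "s \<in> null_sequences v" "cauchy_wrt v t"
  shows "(\<lambda>n. s n * t n) \<in> null_sequences v"
proof -
  obtain T where T: "T > 0" "\<And>n. v (t n) \<le> T"
    using cauchy_wrt_bounded[OF assms(2)] by metis
  have "(\<lambda>n. v (s n * t n)) \<longlonglongrightarrow> 0"
  proof (rule tendsto_sandwich[where f = "\<lambda>n. 0" and h = "\<lambda>n. v (s n) * T"])
    show "(\<lambda>n. v (s n) * T) \<longlonglongrightarrow> 0"
      using assms(1) by (auto simp: null_sequences_def intro: tendsto_mult_left_zero)
    show "\<forall>\<^sub>F n in sequentially. v (s n * t n) \<le> v (s n) * T"
      using T by (simp add: mult mult_left_mono)
  qed simp_all
  then show ?thesis
    by (simp add: null_sequences_def)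
qed

lemma null_sequences_add:
  assumes "s \<in> null_sequences v" "t \<in> null_sequences v"
  shows "(\<lambda>n. s n + t n) \<in> null_sequences v"
proof -
  have "(\<lambda>n. v (s n + t n)) \<longlonglongrightarrow> 0"
  proof (rule tendsto_sandwich[where f = "\<lambda>n. 0" and h = "\<lambda>n. v (s n) + v (t n)"])
    show "(\<lambda>n. v (s n) + v (t n)) \<longlonglongrightarrow> 0"
      using assms by (auto simp: null_sequences_def intro: tendsto_add_zero)
  qed (simp_all add: add_le)
  then show ?thesis
    by (simp add: null_sequences_def)
qed

section \<open>The completion as the quotient of Cauchy by null sequences\<close>

lemma cauchy_ring_simps [simp]:
  "carrier (cauchy_ring v) = {s. cauchy_wrt v s}"
  "s \<otimes>\<^bsub>cauchy_ring v\<^esub> t = (\<lambda>n. s n * t n)"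
  "\<one>\<^bsub>cauchy_ring v\<^esub> = (\<lambda>n. 1)"
  "\<zero>\<^bsub>cauchy_ring v\<^esub> = (\<lambda>n. 0)"
  "s \<oplus>\<^bsub>cauchy_ring v\<^esub> t = (\<lambda>n. s n + t n)"
  by (simp_all add: cauchy_ring_def)

sublocale cauchy: cring "cauchy_ring v"
proof (rule cringI)
  show "abelian_group (cauchy_ring v)"
  proof (rule abelian_groupI)
    fix s assume "s \<in> carrier (cauchy_ring v)"
    then show "\<exists>y\<in>carrier (cauchy_ring v). y \<oplus>\<^bsub>cauchy_ring v\<^esub> s = \<zero>\<^bsub>cauchy_ring v\<^esub>"
      by (intro bexI[of _ "\<lambda>n. - s n"]) (auto simp: cauchy_wrt_uminus)
  qed (auto simp: cauchy_wrt_add cauchy_wrt_const algebra_simps)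
  show "comm_monoid (cauchy_ring v)"
    by unfold_locales (auto simp: cauchy_wrt_mult cauchy_wrt_const algebra_simps)
qed (auto simp: algebra_simps)

sublocale null: ideal "null_sequences v" "cauchy_ring v"
proof (rule idealI)
  show "ring (cauchy_ring v)" by (rule cauchy.ring_axioms)
  show "subgroup (null_sequences v) (add_monoid (cauchy_ring v))"
  proof (rule cauchy.add.subgroupI)
    show "null_sequences v \<subseteq> carrier (cauchy_ring v)"
      using null_sequences_cauchy by auto
    show "null_sequences v \<noteq> {}"
      using null_sequences_iff[of "\<lambda>n. 0"] by auto
  next
    fix s assume s: "s \<in> null_sequences v"
    have "\<ominus>\<^bsub>cauchy_ring v\<^esub> s = (\<lambda>n. - s n)"
      using null_sequences_cauchy[OF s]
      by (intro cauchy.minus_equality) (auto simp: cauchy_wrt_uminus)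
    then show "\<ominus>\<^bsub>cauchy_ring v\<^esub> s \<in> null_sequences v"
      using s by (simp add: null_sequences_def)
  qed (auto simp: null_sequences_add)
qed (auto simp: null_sequences_mult mult.commute)

abbreviation cauchy_class :: "(nat \<Rightarrow> 'a) \<Rightarrow> (nat \<Rightarrow> 'a) set" where
  "cauchy_class s \<equiv> null_sequences v +>\<^bsub>cauchy_ring v\<^esub> s"

sublocale completion: cring "completion v"
  unfolding completion_def by (rule null.quotient_is_cring) (rule cauchy.cring_axioms)

lemma carrier_completion: "carrier (completion v) = {cauchy_class s | s. cauchy_wrt v s}"
  unfolding completion_def FactRing_def A_RCOSETS_def RCOSETS_def a_r_coset_def by auto

lemma cauchy_class_mult:
  "cauchy_wrt v s \<Longrightarrow> cauchy_wrt v t \<Longrightarrow>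
    cauchy_class s \<otimes>\<^bsub>completion v\<^esub> cauchy_class t = cauchy_class (\<lambda>n. s n * t n)"
  using null.rcos_ring_hom unfolding completion_def[symmetric]
  by (auto dest: ring_hom_mult)

lemma cauchy_class_add:
  "cauchy_wrt v s \<Longrightarrow> cauchy_wrt v t \<Longrightarrow>
    cauchy_class s \<oplus>\<^bsub>completion v\<^esub> cauchy_class t = cauchy_class (\<lambda>n. s n + t n)"
  using null.rcos_ring_hom unfolding completion_def[symmetric]
  by (auto dest: ring_hom_add)

lemma cauchy_class_one: "cauchy_class (\<lambda>n. 1) = \<one>\<^bsub>completion v\<^esub>"
  by (simp add: completion_def FactRing_def)

lemma cauchy_class_eq_iff:
  assumes "cauchy_wrt v s" "cauchy_wrt v t"
  shows "cauchy_class s = cauchy_class t \<longleftrightarrow> (\<lambda>n. s n - t n) \<in> null_sequences v"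
proof -
  have "\<ominus>\<^bsub>cauchy_ring v\<^esub> t = (\<lambda>n. - t n)"
    using assms by (intro cauchy.minus_equality) (auto simp: cauchy_wrt_uminus)
  then show ?thesis
    using cauchy.quotient_eq_iff_same_a_r_cos[OF null.is_ideal, of s t] assms
    by (simp add: a_minus_def)
qed

lemma cauchy_class_eq_zero_iff:
  assumes "cauchy_wrt v s"
  shows "cauchy_class s = \<zero>\<^bsub>completion v\<^esub> \<longleftrightarrow> s \<in> null_sequences v"
proof -
  have "\<zero>\<^bsub>completion v\<^esub> = cauchy_class (\<lambda>n. 0)"
    using cauchy.a_rcos_zero[OF null.is_ideal null.zero_closed]
    by (simp add: completion_def FactRing_def)
  then show ?thesis
    using cauchy_class_eq_iff[OF assms cauchy_wrt_const, of 0] by simp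
qed

lemma one_not_null: "(\<lambda>n. 1) \<notin> null_sequences v"
  by (simp add: null_sequences_def LIMSEQ_const_iff)

text \<open>Spans and dimensions in \<open>HOL-Algebra\<close> are taken over a subfield. The
  delicate point is inversion: a rational Cauchy sequence that is not null is inverted termwise and
  stays rational.\<close>

lemma rat_completion_subfield: "subfield (rat_completion v) (completion v)"
proof -
  have mem: "cauchy_class s \<in> rat_completion v" if "cauchy_wrt v s" "\<And>n. s n \<in> \<rat>" for s
    using that unfolding rat_completion_def by blast
  have ex: "\<exists>s. x = cauchy_class s \<and> cauchy_wrt v s \<and> (\<forall>n. s n \<in> \<rat>)" if "x \<in> rat_completion v" for x
    using that unfolding rat_completion_def by auto
  have subset: "rat_completion v \<subseteq> carrier (completion v)"
    unfolding rat_completion_def carrier_completion by blast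
  have subring: "subring (rat_completion v) (completion v)"
  proof (rule completion.subringI[OF subset])
    show "\<one>\<^bsub>completion v\<^esub> \<in> rat_completion v"
      unfolding cauchy_class_one[symmetric] by (rule mem) (simp_all add: cauchy_wrt_const)
  next
    fix x assume "x \<in> rat_completion v"
    then obtain s where s: "x = cauchy_class s" "cauchy_wrt v s" "\<And>n. s n \<in> \<rat>"
      using ex by blast
    have "\<ominus>\<^bsub>completion v\<^esub> x = cauchy_class (\<lambda>n. - s n)"
    proof (rule completion.minus_equality)
      show "cauchy_class (\<lambda>n. - s n) \<oplus>\<^bsub>completion v\<^esub> x = \<zero>\<^bsub>completion v\<^esub>"
        using s by (simp add: cauchy_class_add cauchy_wrt_uminus cauchy_class_eq_zero_iff
            cauchy_wrt_const null_sequences_iff)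
    qed (use s cauchy_wrt_uminus in \<open>auto simp: carrier_completion\<close>)
    then show "\<ominus>\<^bsub>completion v\<^esub> x \<in> rat_completion v"
      using s by (simp add: mem cauchy_wrt_uminus)
  next
    fix x y assume "x \<in> rat_completion v" "y \<in> rat_completion v"
    then obtain s t where "x = cauchy_class s" "cauchy_wrt v s" "\<And>n. s n \<in> \<rat>"
      "y = cauchy_class t" "cauchy_wrt v t" "\<And>n. t n \<in> \<rat>"
      using ex by metis
    then show "x \<otimes>\<^bsub>completion v\<^esub> y \<in> rat_completion v"
      "x \<oplus>\<^bsub>completion v\<^esub> y \<in> rat_completion v"
      by (simp_all add: cauchy_class_mult cauchy_class_add mem cauchy_wrt_mult cauchy_wrt_add)
  qed
  have inverse: "\<exists>y\<in>rat_completion v. y \<otimes>\<^bsub>completion v\<^esub> x = \<one>\<^bsub>completion v\<^esub>"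
    if "x \<in> rat_completion v" "x \<noteq> \<zero>\<^bsub>completion v\<^esub>" for x
  proof -
    obtain s where s: "x = cauchy_class s" "cauchy_wrt v s" "\<And>n. s n \<in> \<rat>"
      using ex \<open>x \<in> rat_completion v\<close> by blast
    have "s \<notin> null_sequences v"
      using that(2) s by (simp add: cauchy_class_eq_zero_iff)
    note inv = cauchy_wrt_inverse[OF s(2) this]
    obtain c K where c: "c > 0" "\<And>n. n \<ge> K \<Longrightarrow> v (s n) \<ge> c"
      using cauchy_wrt_bounded_below[OF s(2) \<open>s \<notin> null_sequences v\<close>] by metis
    \<comment> \<open>The product with the termwise inverse is 1 only from \<open>K\<close> on,
      which is enough modulo null sequences.\<close>
    have "inverse (s n) * s n - 1 = 0" if "n \<ge> K" for n
      using c(1) c(2)[OF that] by (cases "s n = 0") auto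
    then have "(\<lambda>n. inverse (s n) * s n - 1) \<in> null_sequences v"
      unfolding null_sequences_iff by (metis zero)
    then have "cauchy_class (\<lambda>n. inverse (s n)) \<otimes>\<^bsub>completion v\<^esub> x = \<one>\<^bsub>completion v\<^esub>"
      unfolding cauchy_class_one[symmetric] s(1)
      using s inv by (simp add: cauchy_class_mult cauchy_class_eq_iff cauchy_wrt_mult cauchy_wrt_const)
    moreover have "cauchy_class (\<lambda>n. inverse (s n)) \<in> rat_completion v"
      using inv s(3) by (intro mem) auto
    ultimately show ?thesis by blast
  qed
  have one_zero: "\<one>\<^bsub>completion v\<^esub> \<noteq> \<zero>\<^bsub>completion v\<^esub>"
    unfolding cauchy_class_one[symmetric]
    by (simp add: cauchy_class_eq_zero_iff cauchy_wrt_const one_not_null)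
  show ?thesis
  proof (rule completion.subfieldI)
    show "subcring (rat_completion v) (completion v)"
      using subring by (rule completion.subcringI')
    show "Units (completion v\<lparr>carrier := rat_completion v\<rparr>) = rat_completion v - {\<zero>\<^bsub>completion v\<^esub>}"
    proof (intro equalityI subsetI)
      fix x assume "x \<in> Units (completion v\<lparr>carrier := rat_completion v\<rparr>)"
      then obtain y where "x \<in> rat_completion v" "y \<in> rat_completion v"
        "y \<otimes>\<^bsub>completion v\<^esub> x = \<one>\<^bsub>completion v\<^esub>"
        unfolding Units_def by auto
      then show "x \<in> rat_completion v - {\<zero>\<^bsub>completion v\<^esub>}"
        using one_zero subset by auto
    next
      fix x assume x: "x \<in> rat_completion v - {\<zero>\<^bsub>completion v\<^esub>}"
      then obtain y where y: "y \<in> rat_completion v" "y \<otimes>\<^bsub>completion v\<^esub> x = \<one>\<^bsub>completion v\<^esub>"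
        using inverse by blast
      then have "x \<otimes>\<^bsub>completion v\<^esub> y = \<one>\<^bsub>completion v\<^esub>"
        using x subset completion.m_comm[of x y] by auto
      then show "x \<in> Units (completion v\<lparr>carrier := rat_completion v\<rparr>)"
        using x y unfolding Units_def by auto
    qed
  qed
qed

section \<open>Linear independence over the rational completion, in terms of sequences\<close>

lemma cauchy_wrt_sum:
  fixes n :: nat
  assumes "\<And>k. k < n \<Longrightarrow> cauchy_wrt v (s k)"
  shows "cauchy_wrt v (\<lambda>m. \<Sum>k<n. s k m)"
  using assms by (induction n) (simp_all add: cauchy_wrt_const cauchy_wrt_add)

text \<open>The rational coefficients vary with the index \<open>m\<close>: for each
  \<open>k\<close> they represent one element of \<open>rat_completion v\<close>, so the class is a
  combination of \<open>Us\<close> over that field.\<close>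

lemma cauchy_class_sum_in_Span:
  fixes n :: nat
  assumes Us: "set Us \<subseteq> carrier (completion v)"
    and s: "\<And>k. k < n \<Longrightarrow> cauchy_wrt v (s k)" "\<And>k. k < n \<Longrightarrow> cauchy_class (s k) \<in> set Us"
    and q: "\<And>k. k < n \<Longrightarrow> cauchy_wrt v (\<lambda>m. of_rat (q k m))"
  shows "cauchy_class (\<lambda>m. \<Sum>k<n. of_rat (q k m) * s k m) \<in> completion.Span (rat_completion v) Us"
  using s q
proof (induction n)
  case 0
  have "cauchy_class (\<lambda>m. 0) = \<zero>\<^bsub>completion v\<^esub>"
    by (simp add: cauchy_class_eq_zero_iff cauchy_wrt_const null_sequences_iff)
  then show ?case
    using completion.Span_subgroup_props(2)[OF rat_completion_subfield Us] by simp
next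
  case (Suc n)
  have "cauchy_class (\<lambda>m. of_rat (q n m)) \<in> rat_completion v"
    using Suc.prems(3)[of n] unfolding rat_completion_def by auto
  moreover have "cauchy_class (s n) \<in> completion.Span (rat_completion v) Us"
    using completion.Span_base_incl[OF rat_completion_subfield Us] Suc.prems(2)[of n] by auto
  ultimately have "cauchy_class (\<lambda>m. of_rat (q n m)) \<otimes>\<^bsub>completion v\<^esub> cauchy_class (s n)
      \<in> completion.Span (rat_completion v) Us"
    by (rule completion.Span_smult_closed[OF rat_completion_subfield Us])
  then have "cauchy_class (\<lambda>m. \<Sum>k<n. of_rat (q k m) * s k m) \<oplus>\<^bsub>completion v\<^esub>
      cauchy_class (\<lambda>m. of_rat (q n m) * s n m) \<in> completion.Span (rat_completion v) Us"
    using Suc by (intro completion.Span_subgroup_props(3)[OF rat_completion_subfield Us])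
      (simp_all add: cauchy_class_mult del: completion.Span.simps)
  then show ?case
    using Suc.prems by (simp add: cauchy_class_add cauchy_wrt_sum cauchy_wrt_mult
        del: completion.Span.simps)
qed

lemma cauchy_wrt_uniform:
  fixes n :: nat
  assumes "\<And>k. k < n \<Longrightarrow> cauchy_wrt v (s k)" "e > 0"
  shows "\<exists>J. \<forall>a\<ge>J. \<forall>b\<ge>J. (\<Sum>k<n. v (s k a - s k b)) < e"
  using assms
proof (induction n arbitrary: e)
  case (Suc n)
  obtain J1 where J1: "\<And>a b. a \<ge> J1 \<Longrightarrow> b \<ge> J1 \<Longrightarrow> (\<Sum>k<n. v (s k a - s k b)) < e / 2"
    using Suc.IH[of "e / 2"] Suc.prems by fastforce
  obtain J2 where J2: "\<And>a b. a \<ge> J2 \<Longrightarrow> b \<ge> J2 \<Longrightarrow> v (s n a - s n b) < e / 2"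
    using Suc.prems(1)[of n] half_gt_zero[OF Suc.prems(2)] unfolding cauchy_wrt_def
    by (metis lessI)
  have "(\<Sum>k<Suc n. v (s k a - s k b)) < e" if "a \<ge> max J1 J2" "b \<ge> max J1 J2" for a b
    using J1[of a b] J2[of a b] that by simp
  then show ?case
    by blast
qed simp

text \<open>
  A finite-dimensional space over a complete field is closed, hence a vector outside the span of
  \<open>Us\<close> keeps a positive distance from it. Everything is expressed through representing sequences.
\<close>

lemma dist_Span_pos:
  fixes n :: nat
  assumes Us: "set Us \<subseteq> carrier (completion v)"
    and s: "\<And>k. k < n \<Longrightarrow> cauchy_wrt v (s k)" "\<And>k. k < n \<Longrightarrow> cauchy_class (s k) \<in> set Us"
    and c: "c > 0"
      "\<And>m q k. m \<ge> K \<Longrightarrow> k < n \<Longrightarrow> c * v (of_rat (q k)) \<le> v (\<Sum>k<n. of_rat (q k) * s k m)"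
    and t: "cauchy_wrt v t" "cauchy_class t \<notin> completion.Span (rat_completion v) Us"
  shows "\<exists>\<delta>>0. \<exists>K'. \<forall>m\<ge>K'. \<forall>q. \<delta> \<le> v (t m + (\<Sum>k<n. of_rat (q k) * s k m))"
proof (rule ccontr)
  assume "\<not> ?thesis"
  \<comment> \<open>If no distance works, then for each \<open>j\<close> some rational combination
    at a late index is within 1 / (j + 1) of \<open>- t\<close>. These approximations will be shown
    to converge.\<close>
  then have "\<exists>m q. m \<ge> max j K \<and> v (t m + (\<Sum>k<n. of_rat (q k) * s k m)) < 1 / real (Suc j)" for j
    by (meson not_le of_nat_0_less_iff zero_less_Suc zero_less_divide_1_iff)
  then obtain m q where
    m: "\<And>j. m j \<ge> max j K" and
    mq: "\<And>j. v (t (m j) + (\<Sum>k<n. of_rat (q j k) * s k (m j))) < 1 / real (Suc j)"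
    by metis
  define W where "W j a = (\<Sum>k<n. of_rat (q j k) * s k a)" for j a
  have mj: "m j \<ge> j" "m j \<ge> K" for j
    using m[of j] by simp_all
  have W: "v (t (m j) + W j (m j)) < 1 / real (Suc j)" for j
    using mq by (simp add: W_def)
  obtain T where T: "T > 0" "\<And>a. v (t a) \<le> T"
    using cauchy_wrt_bounded[OF t(1)] by metis
  \<comment> \<open>The lower bound \<open>c\<close> confines the coefficients: each combination
    nearly cancels \<open>t\<close>, so its value is at most \<open>T + 1\<close>.\<close>
  define R where "R = (T + 1) / c"
  have R: "v (of_rat (q j k)) \<le> R" if "k < n" for j k
  proof -
    have "c * v (of_rat (q j k)) \<le> v (W j (m j))"
      unfolding W_def by (rule c(2)[OF mj(2) that])
    also have "\<dots> \<le> v (t (m j) + W j (m j)) + v (t (m j))"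
      using diff_le[of "t (m j) + W j (m j)" "t (m j)"] by simp
    also have "\<dots> \<le> 1 + T"
      using W[of j] T(2)[of "m j"] by (intro add_mono) (auto intro: order.trans less_imp_le)
    finally show ?thesis
      using c(1) by (simp add: R_def pos_le_divide_eq mult.commute add.commute)
  qed
  have "R > 0"
    using T(1) c(1) by (simp add: R_def)
  have W_diff: "v (W j a - W j b) \<le> R * (\<Sum>k<n. v (s k a - s k b))" for j a b
  proof -
    have "v (W j a - W j b) = v (\<Sum>k<n. of_rat (q j k) * (s k a - s k b))"
      by (simp add: W_def sum_subtractf right_diff_distrib)
    also have "\<dots> \<le> (\<Sum>k<n. R * v (s k a - s k b))"
      by (rule order.trans[OF sum_le]) (auto simp: mult intro!: sum_mono mult_right_mono R)
    finally show ?thesis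
      by (simp add: sum_distrib_left)
  qed
  \<comment> \<open>One \<open>J\<close> serves all three estimates; the last is uniform in
    \<open>i\<close> because all coefficients are bounded by \<open>R\<close>.\<close>
  have small: "\<exists>J. \<forall>a\<ge>J. \<forall>b\<ge>J. \<forall>j\<ge>J. v (t (m j) + W j (m j)) < e \<and> v (t a - t b) < e \<and>
      (\<forall>i. v (W i a - W i b) < e)" if "e > 0" for e
  proof -
    have "e / R > 0"
      using that \<open>R > 0\<close> by simp
    then obtain J1 where J1: "\<And>a b. a \<ge> J1 \<Longrightarrow> b \<ge> J1 \<Longrightarrow> (\<Sum>k<n. v (s k a - s k b)) < e / R"
      using cauchy_wrt_uniform[of n s "e / R"] s(1) by blast
    obtain J2 where J2: "\<And>a b. a \<ge> J2 \<Longrightarrow> b \<ge> J2 \<Longrightarrow> v (t a - t b) < e"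
      using t(1) \<open>e > 0\<close> unfolding cauchy_wrt_def by metis
    obtain J3 where J3: "1 / real (Suc J3) < e"
      using \<open>e > 0\<close> nat_approx_posE by blast
    have "v (t (m j) + W j (m j)) < e" if "j \<ge> J3" for j
    proof -
      have "1 / real (Suc j) \<le> 1 / real (Suc J3)"
        using that by (simp add: frac_le)
      then show ?thesis
        using W[of j] J3 by linarith
    qed
    moreover have "v (W i a - W i b) < e" if "a \<ge> J1" "b \<ge> J1" for i a b
    proof -
      have "R * (\<Sum>k<n. v (s k a - s k b)) < e"
        using J1[OF that] \<open>R > 0\<close> by (simp add: pos_less_divide_eq mult.commute)
      then show ?thesis
        using W_diff[of i a b] by linarith
    qed
    ultimately show ?thesis
      using J2 by (intro exI[of _ "Max {J1, J2, J3}"]) auto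
  qed
  \<comment> \<open>The lower bound \<open>c\<close>, applied at the common index \<open>m i\<close>
    to the difference of two coefficient vectors, turns closeness of the combinations into closeness
    of the coefficients.\<close>
  have q: "cauchy_wrt v (\<lambda>j. of_rat (q j k))" if "k < n" for k
    unfolding cauchy_wrt_def
  proof (intro allI impI)
    fix e :: real assume "e > 0"
    then have "c * e / 4 > 0"
      using c(1) by simp
    then obtain J where J: "\<And>a b j. a \<ge> J \<Longrightarrow> b \<ge> J \<Longrightarrow> j \<ge> J \<Longrightarrow>
      v (t (m j) + W j (m j)) < c * e / 4 \<and> v (t a - t b) < c * e / 4 \<and>
      (\<forall>i. v (W i a - W i b) < c * e / 4)"
      using small by metis
    have "v (of_rat (q i k) - of_rat (q j k)) < e" if "i \<ge> J" "j \<ge> J" for i j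
    proof -
      have ij: "m i \<ge> J" "m j \<ge> J"
        using mj(1)[of i] mj(1)[of j] that by simp_all
      have "c * v (of_rat (q i k - q j k)) \<le> v (\<Sum>k<n. of_rat (q i k - q j k) * s k (m i))"
        using c(2)[OF mj(2) \<open>k < n\<close>, of "\<lambda>k. q i k - q j k" i] .
      also have "(\<Sum>k<n. of_rat (q i k - q j k) * s k (m i)) = W i (m i) - W j (m i)"
        by (simp add: W_def of_rat_diff sum_subtractf left_diff_distrib)
      also have "\<dots> = (t (m i) + W i (m i)) - (t (m j) + W j (m j)) - (t (m i) - t (m j))
          + (W j (m j) - W j (m i))"
        by simp
      also have "v \<dots> \<le> v (t (m i) + W i (m i)) + v (t (m j) + W j (m j)) + v (t (m i) - t (m j))
          + v (W j (m j) - W j (m i))"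
        by (intro order.trans[OF add_le] add_right_mono order.trans[OF diff_le] order.refl)
      also have "\<dots> < c * e / 4 + c * e / 4 + c * e / 4 + c * e / 4"
        using J[OF ij that(1)] J[OF ij(2,1) that(2)] by (intro add_strict_mono) blast+
      also have "\<dots> = c * e"
        by simp
      finally show ?thesis
        using c(1) by (simp add: of_rat_diff)
    qed
    then show "\<exists>J. \<forall>i\<ge>J. \<forall>j\<ge>J. v (of_rat (q i k) - of_rat (q j k)) < e"
      by blast
  qed
  \<comment> \<open>On the diagonal the combination with coefficients \<open>q j\<close> is read at
    \<open>j\<close> instead of \<open>m j\<close>; \<open>small\<close> pays for the
    change.\<close>
  have null: "(\<lambda>j. t j + W j j) \<in> null_sequences v"
    unfolding null_sequences_iff
  proof (intro allI impI)
    fix e :: real assume "e > 0"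
    then have "e / 3 > 0"
      by simp
    then obtain J where J: "\<And>a b j. a \<ge> J \<Longrightarrow> b \<ge> J \<Longrightarrow> j \<ge> J \<Longrightarrow>
      v (t (m j) + W j (m j)) < e / 3 \<and> v (t a - t b) < e / 3 \<and> (\<forall>i. v (W i a - W i b) < e / 3)"
      using small by metis
    have "v (t j + W j j) < e" if "j \<ge> J" for j
    proof -
      have "t j + W j j = (t (m j) + W j (m j)) + (t j - t (m j)) + (W j j - W j (m j))"
        by simp
      also have "v \<dots> \<le> v (t (m j) + W j (m j)) + v (t j - t (m j)) + v (W j j - W j (m j))"
        by (intro order.trans[OF add_le] add_right_mono order.refl)
      also have "\<dots> < e / 3 + e / 3 + e / 3"
        using J[OF that order.trans[OF that mj(1)] that] by (intro add_strict_mono) blast+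
      also have "\<dots> = e"
        by simp
      finally show ?thesis .
    qed
    then show "\<exists>J. \<forall>j\<ge>J. v (t j + W j j) < e"
      by blast
  qed
  \<comment> \<open>With the sign moved into the coefficients, \<open>t\<close> itself is equivalent
    to a combination, against its choice outside the span.\<close>
  define W' where "W' = (\<lambda>j. \<Sum>k<n. of_rat (- q j k) * s k j)"
  have q': "cauchy_wrt v (\<lambda>j. of_rat (- q j k))" if "k < n" for k
    using cauchy_wrt_uminus[OF q[OF that]] by (simp add: of_rat_minus)
  have "cauchy_class W' \<in> completion.Span (rat_completion v) Us"
    unfolding W'_def by (rule cauchy_class_sum_in_Span[OF Us]) (use s q' in auto)
  moreover have "(\<lambda>j. t j - W' j) = (\<lambda>j. t j + W j j)"
    by (simp add: W'_def W_def of_rat_minus sum_negf)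
  then have "(\<lambda>j. t j - W' j) \<in> null_sequences v"
    using null by simp
  moreover have "cauchy_wrt v W'"
    unfolding W'_def by (intro cauchy_wrt_sum cauchy_wrt_mult q' s(1))
  ultimately have "cauchy_class t \<in> completion.Span (rat_completion v) Us"
    using cauchy_class_eq_iff[OF t(1)] by metis
  then show False
    using t(2) by simp
qed

text \<open>The equivalence of norms on a finite-dimensional space over a complete field, in the
  direction that bounds coordinates. The induction step adds a vector at positive distance from the
  span of the others; it is essential that \<open>c\<close> and \<open>K\<close> do not depend on
  \<open>q\<close>.\<close>

lemma independent_sequences_lower_bound:
  assumes "completion.independent (rat_completion v) Us"
  shows "\<exists>s. (\<forall>k<length Us. cauchy_wrt v (s k) \<and> cauchy_class (s k) \<in> set Us) \<and>
    (\<exists>c>0. \<exists>K. \<forall>m\<ge>K. \<forall>q. \<forall>k<length Us.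
      c * v (of_rat (q k)) \<le> v (\<Sum>k<length Us. of_rat (q k) * s k m))"
  using assms
proof (induction Us rule: list.induct)
  case Nil
  show ?case
    by (auto intro: exI[of _ "1 :: real"])
next
  case (Cons u Us)
  define n where "n = length Us"
  have Us: "set Us \<subseteq> carrier (completion v)"
    and u: "u \<in> carrier (completion v)" "u \<notin> completion.Span (rat_completion v) Us"
    and ind: "completion.independent (rat_completion v) Us"
    using completion.independent_backwards[OF Cons.prems]
      completion.independent_in_carrier[OF Cons.prems] by auto
  obtain s c K where s: "\<And>k. k < n \<Longrightarrow> cauchy_wrt v (s k)" "\<And>k. k < n \<Longrightarrow> cauchy_class (s k) \<in> set Us"
    and c: "c > 0"
      "\<And>m q k. m \<ge> K \<Longrightarrow> k < n \<Longrightarrow> c * v (of_rat (q k)) \<le> v (\<Sum>k<n. of_rat (q k) * s k m)"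
    using Cons.IH[OF ind] unfolding n_def[symmetric] by blast
  obtain t where t: "cauchy_wrt v t" "u = cauchy_class t"
    using u(1) unfolding carrier_completion by blast
  have "\<exists>\<delta>>0. \<exists>K'. \<forall>m\<ge>K'. \<forall>q. \<delta> \<le> v (t m + (\<Sum>k<n. of_rat (q k) * s k m))"
    using s c t u(2) by (intro dist_Span_pos[OF Us, of n s c K]) auto
  then obtain \<delta> K' where \<delta>: "\<delta> > 0"
      "\<And>m q. m \<ge> K' \<Longrightarrow> \<delta> \<le> v (t m + (\<Sum>k<n. of_rat (q k) * s k m))"
    by blast
  obtain T where T: "T > 0" "\<And>a. v (t a) \<le> T"
    using cauchy_wrt_bounded[OF t(1)] by metis
  \<comment> \<open>\<open>\<delta>\<close> controls the new coefficient. For the old ones the new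
    term is moved to the other side, which enlarges the bound by the factor
    \<open>1 + T / \<delta>\<close>.\<close>
  define c' where "c' = min \<delta> (c / (1 + T / \<delta>))"
  have "c' > 0"
    using c(1) \<delta>(1) T(1) by (simp add: c'_def add_pos_pos)
  have main: "c' * v (of_rat (q k)) \<le> v ((\<Sum>k<n. of_rat (q k) * s k m) + of_rat (q n) * t m)"
    if "m \<ge> max K K'" "k < Suc n" for m q k
  proof -
    define S where "S = (\<Sum>k<n. of_rat (q k) * s k m)"
    have n: "\<delta> * v (of_rat (q n)) \<le> v (S + of_rat (q n) * t m)"
    proof (cases "q n = 0")
      case False
      \<comment> \<open>Division by \<open>q n\<close> gives \<open>t\<close> the coefficient
        1.\<close>
      have "\<delta> \<le> v (t m + (\<Sum>k<n. of_rat (q k / q n) * s k m))"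
        using \<delta>(2)[of m "\<lambda>k. q k / q n"] that(1) by simp
      also have "(\<Sum>k<n. of_rat (q k / q n) * s k m) = S / of_rat (q n)"
        by (simp add: S_def of_rat_divide sum_divide_distrib)
      also have "t m + S / of_rat (q n) = (S + of_rat (q n) * t m) / of_rat (q n)"
        using False by (simp add: field_simps)
      finally show ?thesis
        using False by (simp add: divide pos_le_divide_eq)
    qed simp
    show ?thesis
    proof (cases "k = n")
      case True
      have "c' * v (of_rat (q n)) \<le> \<delta> * v (of_rat (q n))"
        by (simp add: c'_def mult_right_mono)
      then show ?thesis
        using n True unfolding S_def by simp
    next
      case False
      then have "c * v (of_rat (q k)) \<le> v S"
        unfolding S_def using that by (intro c(2)) auto
      also have "\<dots> \<le> v (S + of_rat (q n) * t m) + v (of_rat (q n)) * v (t m)"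
        using diff_le[of "S + of_rat (q n) * t m" "of_rat (q n) * t m"] by (simp add: mult)
      also have "\<dots> \<le> v (S + of_rat (q n) * t m) + v (S + of_rat (q n) * t m) / \<delta> * T"
        using n \<delta>(1) T by (intro add_left_mono mult_mono) (auto simp: pos_le_divide_eq mult.commute)
      also have "\<dots> = v (S + of_rat (q n) * t m) * (1 + T / \<delta>)"
        by (simp add: algebra_simps)
      finally have "c / (1 + T / \<delta>) * v (of_rat (q k)) \<le> v (S + of_rat (q n) * t m)"
        using T(1) \<delta>(1) by (simp add: pos_divide_le_eq add_pos_pos)
      moreover have "c' * v (of_rat (q k)) \<le> c / (1 + T / \<delta>) * v (of_rat (q k))"
        by (intro mult_right_mono) (simp_all add: c'_def)
      ultimately show ?thesis
        unfolding S_def by simp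
    qed
  qed
  show ?case
  \<comment> \<open>The head \<open>u\<close> of the list gets the last index \<open>n\<close>: only
    membership of the classes in \<open>set (u # Us)\<close> is recorded, so the order is
    free.\<close>
  proof (intro exI[of _ "s(n := t)"] conjI allI impI exI[of _ c'] exI[of _ "max K K'"])
    fix k assume "k < length (u # Us)"
    then show "cauchy_wrt v ((s(n := t)) k)" "cauchy_class ((s(n := t)) k) \<in> set (u # Us)"
      using s t by (auto simp: n_def less_Suc_eq)
  next
    fix m k and q :: "nat \<Rightarrow> rat" assume "m \<ge> max K K'" "k < length (u # Us)"
    then show "c' * v (of_rat (q k)) \<le> v (\<Sum>k<length (u # Us). of_rat (q k) * (s(n := t)) k m)"
      using main[of m k q] by (simp add: n_def)
  qed (rule \<open>c' > 0\<close>)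
qed

text \<open>Uniformity in \<open>q\<close> allows all sequences to be frozen at one index, which
  replaces elements of the completion by elements of the field.\<close>

lemma independent_elements_lower_bound:
  assumes "completion.independent (rat_completion v) Us"
  shows "\<exists>a. \<exists>c>0. \<forall>q. \<forall>k<length Us.
    c * v (of_rat (q k)) \<le> v (\<Sum>k<length Us. of_rat (q k) * a k)"
proof -
  obtain s :: "nat \<Rightarrow> nat \<Rightarrow> 'a" and c :: real and K :: nat where "c > 0"
    "\<forall>m\<ge>K. \<forall>q. \<forall>k<length Us. c * v (of_rat (q k)) \<le> v (\<Sum>k<length Us. of_rat (q k) * s k m)"
    using independent_sequences_lower_bound[OF assms] by blast
  then show ?thesis
    by (intro exI[of _ "\<lambda>k. s k K"] exI[of _ c]) simp
qed

end

section \<open>Weak approximation\<close>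

context valued_field
begin

lemma power_int: "v (x powi m) = v x powi m"
  by (simp add: power_int_def power inverse)

text \<open>Together with the next lemma: large powers turn \<open>z\<close> into an element close
  to 1 at places where \<open>z\<close> is large and close to 0 where it is small, as weak
  approximation requires.\<close>

lemma tendsto_power_div_one_plus_gt1:
  assumes "v z > 1"
  shows "(\<lambda>r. v (z ^ r / (1 + z ^ r) - 1)) \<longlonglongrightarrow> 0"
proof (rule tendsto_sandwich[where f = "\<lambda>r. 0" and h = "\<lambda>r. inverse (- 1 + v z ^ r)"])
  show "(\<lambda>r. inverse (- 1 + v z ^ r)) \<longlonglongrightarrow> 0"
    using assms by (intro filterlim_compose[OF tendsto_inverse_0]
        tendsto_add_filterlim_at_infinity[OF tendsto_const] filterlim_realpow_sequentially_gt1) simp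
  have "v (z ^ r / (1 + z ^ r) - 1) \<le> inverse (- 1 + v z ^ r)" if "r \<ge> 1" for r
  proof -
    have "v z ^ r > 1"
      using assms that by (simp add: one_less_power)
    moreover have "v z ^ r \<le> v (1 + z ^ r) + 1"
      using diff_le[of "1 + z ^ r" 1] by (simp add: power)
    ultimately have le: "0 < - 1 + v z ^ r" "- 1 + v z ^ r \<le> v (1 + z ^ r)"
      by simp_all
    then have "1 + z ^ r \<noteq> 0"
      by auto
    then have "z ^ r / (1 + z ^ r) - 1 = - inverse (1 + z ^ r)"
      by (simp add: field_simps)
    then show ?thesis
      using le by (simp add: inverse le_imp_inverse_le)
  qed
  then show "\<forall>\<^sub>F r in sequentially. v (z ^ r / (1 + z ^ r) - 1) \<le> inverse (- 1 + v z ^ r)"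
    unfolding eventually_sequentially by blast
qed simp_all

lemma tendsto_power_div_one_plus_lt1:
  assumes "v z < 1"
  shows "(\<lambda>r. v (z ^ r / (1 + z ^ r))) \<longlonglongrightarrow> 0"
proof (rule tendsto_sandwich[where f = "\<lambda>r. 0" and h = "\<lambda>r. v z ^ r / (1 - v z ^ r)"])
  have lim: "(\<lambda>r. v z ^ r) \<longlonglongrightarrow> 0"
    using assms by (intro LIMSEQ_power_zero) simp
  then have "(\<lambda>r. v z ^ r / (1 - v z ^ r)) \<longlonglongrightarrow> 0 / (1 - 0)"
    by (intro tendsto_divide tendsto_diff tendsto_const) simp_all
  then show "(\<lambda>r. v z ^ r / (1 - v z ^ r)) \<longlonglongrightarrow> 0"
    by simp
  have "v (z ^ r / (1 + z ^ r)) \<le> v z ^ r / (1 - v z ^ r)" if "v z ^ r < 1" for r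
  proof -
    have "1 - v z ^ r \<le> v (1 + z ^ r)"
      using diff_le[of "1 + z ^ r" "z ^ r"] by (simp add: power)
    then show ?thesis
      using that by (simp add: divide power frac_le)
  qed
  moreover have "\<forall>\<^sub>F r in sequentially. v z ^ r < 1"
    using lim by (rule order_tendstoD) simp
  ultimately show "\<forall>\<^sub>F r in sequentially. v (z ^ r / (1 + z ^ r)) \<le> v z ^ r / (1 - v z ^ r)"
    by (auto elim: eventually_mono)
qed simp_all

end

text \<open>
  Absolute values with a prescribed restriction to the rationals. Fixing the restriction makes
  two equivalent ones equal.
\<close>

definition extensions :: "(rat \<Rightarrow> real) \<Rightarrow> ('a::field_char_0 \<Rightarrow> real) set" where
  "extensions r = {v. absolute_value v \<and> (\<forall>q. v (of_rat q) = r q)}"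

text \<open>If v x < w x, a fraction m / n lies strictly between the logarithms of these values to
  base \<open>r y\<close>, and x^n / y^m is then less than 1 at \<open>v\<close> but greater than 1
  at \<open>w\<close>. So \<open>w\<close> is at most \<open>v\<close>, and inverses give
  equality.\<close>

lemma extensions_eqI:
  assumes v: "v \<in> extensions r" and w: "w \<in> extensions r" and y: "r y > 1"
    and dom: "\<And>x. v x < 1 \<Longrightarrow> w x < 1"
  shows "v = w"
proof -
  interpret v: valued_field v
    using v by unfold_locales (simp add: extensions_def)
  interpret w: valued_field w
    using w by unfold_locales (simp add: extensions_def)
  define Y :: 'a where "Y = of_rat y"
  have Y: "v Y = r y" "w Y = r y"
    using v w by (simp_all add: Y_def extensions_def)
  have le: "w x \<le> v x" for x
  proof (rule ccontr)
    assume "\<not> w x \<le> v x"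
    then have less: "v x < w x"
      by simp
    then have x: "x \<noteq> 0"
      by auto
    define L where "L = ln (r y)"
    have "L > 0"
      using y by (simp add: L_def)
    have "ln (w x) - ln (v x) > 0"
      using less x by simp
    \<comment> \<open>Scaling by \<open>n\<close> makes the gap between the logarithms longer than
      \<open>L\<close>, so that it contains a multiple \<open>m * L\<close>.\<close>
    then obtain n where n: "L < real n * (ln (w x) - ln (v x))"
      using reals_Archimedean3 by blast
    define m where "m = \<lfloor>real n * ln (v x) / L\<rfloor> + 1"
    have "real n * ln (v x) / L < of_int m" "of_int m \<le> real n * ln (v x) / L + 1"
      unfolding m_def by linarith+
    then have "real n * ln (v x) < of_int m * L" "of_int m * L \<le> real n * ln (v x) + L"
      using \<open>L > 0\<close> by (simp_all add: field_simps)
    then have m: "real n * ln (v x) < of_int m * L" "of_int m * L < real n * ln (w x)"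
      using n by (simp_all add: algebra_simps)
    have pow: "r y powi m = exp (of_int m * L)"
      using y powr_real_of_int'[of "r y" m] by (simp add: L_def powr_def)
    have exp: "v x ^ n = exp (real n * ln (v x))" "w x ^ n = exp (real n * ln (w x))"
      using x by (simp_all add: exp_of_nat_mult)
    have "v (x ^ n / Y powi m) < 1"
      using m(1) by (simp add: v.divide v.power v.power_int Y pow exp)
    then have "w (x ^ n / Y powi m) < 1"
      by (rule dom)
    then show False
      using m(2) by (simp add: w.divide w.power w.power_int Y pow exp)
  qed
  show ?thesis
  proof
    fix x
    show "v x = w x"
    proof (cases "x = 0")
      case False
      then show ?thesis
        using le[of x] le[of "inverse x"] by (simp add: v.inverse w.inverse)
    qed simp
  qed
qed

text \<open>By \<open>extensions_eqI\<close> neither open unit disc contains the other; the quotient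
  of two witnesses works.\<close>

lemma extensions_separate_pair:
  assumes v: "v \<in> extensions r" and w: "w \<in> extensions r" and y: "r y > 1" and "v \<noteq> w"
  obtains x where "v x > 1" "w x < 1"
proof -
  interpret v: valued_field v
    using v by unfold_locales (simp add: extensions_def)
  interpret w: valued_field w
    using w by unfold_locales (simp add: extensions_def)
  obtain a where a: "v a < 1" "w a \<ge> 1"
    using extensions_eqI[OF v w y] \<open>v \<noteq> w\<close> by (meson not_le)
  obtain b where b: "w b < 1" "v b \<ge> 1"
    using extensions_eqI[OF w v y] \<open>v \<noteq> w\<close> by (metis not_le)
  have "a \<noteq> 0"
    using a(2) by auto
  then have "v (b / a) > 1" "w (b / a) < 1"
    using a b by (simp_all add: v.divide w.divide less_divide_eq divide_less_eq)
  then show thesis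
    by (rule that)
qed

text \<open>Induction on \<open>S\<close>: an element \<open>z\<close> good for \<open>S\<close> is
  combined with an \<open>x\<close> that separates \<open>v\<close> from the new \<open>w\<close>.
  How \<open>z\<close> enters depends on its size at \<open>w\<close>.\<close>

lemma extensions_separate:
  assumes "finite S" "insert v S \<subseteq> extensions r" "r y > 1" "v \<notin> S"
  shows "\<exists>z. v z > 1 \<and> (\<forall>w\<in>S. w z < 1)"
  using assms
proof (induction S rule: finite_induct)
  case empty
  then show ?case
    by (intro exI[of _ "of_rat y"]) (simp add: extensions_def)
next
  case (insert w S)
  have ext: "v \<in> extensions r" "w \<in> extensions r"
    and vf: "\<And>u. u \<in> insert v (insert w S) \<Longrightarrow> valued_field u"
    using insert.prems by (auto simp: extensions_def valued_field_def)
  interpret v: valued_field v by (rule vf) simp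
  interpret w: valued_field w by (rule vf) simp
  obtain z where z: "v z > 1" "\<And>u. u \<in> S \<Longrightarrow> u z < 1"
    using insert by auto
  obtain x where x: "v x > 1" "w x < 1"
    using extensions_separate_pair[OF ext insert.prems(2)] insert.prems(3) by auto
  show ?case
  proof (cases "w z \<le> 1")
    \<comment> \<open>A high power of \<open>z\<close> outweighs \<open>x\<close> on
      \<open>S\<close> and does no harm at \<open>v\<close> or \<open>w\<close>.\<close>
    case True
    have "\<forall>\<^sub>F r in sequentially. u (z ^ r * x) < 1" if "u \<in> S" for u
    proof -
      interpret u: valued_field u by (rule vf) (use that in simp)
      have "(\<lambda>r. u z ^ r * u x) \<longlonglongrightarrow> 0 * u x"
        using z(2)[OF that] by (intro tendsto_intros LIMSEQ_power_zero) simp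
      then have "(\<lambda>r. u (z ^ r * x)) \<longlonglongrightarrow> 0"
        by (simp add: u.mult u.power)
      then show ?thesis
        by (rule order_tendstoD) simp
    qed
    then have "\<forall>\<^sub>F r in sequentially. \<forall>u\<in>S. u (z ^ r * x) < 1"
      using insert.hyps by (simp add: eventually_ball_finite)
    then obtain r where r: "\<forall>u\<in>S. u (z ^ r * x) < 1"
      unfolding eventually_sequentially by blast
    have "1 * 1 < v z ^ r * v x"
      using z(1) x(1) by (intro mult_le_less_imp_less) (simp_all add: one_le_power)
    moreover have "w z ^ r * w x < 1"
      using True x(2) mult_left_le_one_le[of "w x" "w z ^ r"] by (simp add: power_le_one)
    ultimately show ?thesis
      using r by (intro exI[of _ "z ^ r * x"]) (simp add: v.mult v.power w.mult w.power)
  next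
    case False
    \<comment> \<open>Powers of \<open>z\<close> would blow up at \<open>w\<close>. Instead
      \<open>t r\<close> tends to 1 at both \<open>v\<close> and \<open>w\<close> and to 0 on
      \<open>S\<close>, so that only \<open>x\<close> counts at \<open>v\<close> and
      \<open>w\<close>.\<close>
    define t where "t r = z ^ r / (1 + z ^ r)" for r
    have one: "(\<lambda>r. u (t r * x)) \<longlonglongrightarrow> u x" if "valued_field u" "u z > 1" for u
    proof -
      interpret u: valued_field u by fact
      have "(\<lambda>r. u (t r - 1) * u x) \<longlonglongrightarrow> 0 * u x"
        unfolding t_def using that by (intro tendsto_intros u.tendsto_power_div_one_plus_gt1)
      then have lim: "(\<lambda>r. u (t r - 1) * u x) \<longlonglongrightarrow> 0"
        by simp
      have "\<bar>u (t r * x) - u x\<bar> \<le> u (t r - 1) * u x" for r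
      proof -
        have "u (t r * x - x) = u (t r - 1) * u x"
          by (simp add: u.mult[symmetric] algebra_simps)
        then show ?thesis
          using u.le_add_diff[of "t r * x" x] u.le_add_diff[of x "t r * x"]
            u.minus_commute[of x "t r * x"] by linarith
      qed
      then have "(\<lambda>r. u (t r * x) - u x) \<longlonglongrightarrow> 0"
        by (intro Lim_null_comparison[OF _ lim]) simp
      then show ?thesis
        by (simp add: LIM_zero_iff)
    qed
    have "\<forall>\<^sub>F r in sequentially. u (t r * x) < 1" if "u \<in> S" for u
    proof -
      interpret u: valued_field u by (rule vf) (use that in simp)
      have "(\<lambda>r. u (t r) * u x) \<longlonglongrightarrow> 0 * u x"
        unfolding t_def using z(2)[OF that] by (intro tendsto_intros u.tendsto_power_div_one_plus_lt1)
      then have "(\<lambda>r. u (t r * x)) \<longlonglongrightarrow> 0"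
        by (simp add: u.mult)
      then show ?thesis
        by (rule order_tendstoD) simp
    qed
    then have "\<forall>\<^sub>F r in sequentially. \<forall>u\<in>S. u (t r * x) < 1"
      using insert.hyps by (simp add: eventually_ball_finite)
    moreover have "\<forall>\<^sub>F r in sequentially. v (t r * x) > 1"
      using one[OF v.valued_field_axioms z(1)] x(1) by (rule order_tendstoD)
    moreover have "\<forall>\<^sub>F r in sequentially. w (t r * x) < 1"
      using one[OF w.valued_field_axioms] False x(2) by (intro order_tendstoD(2)[of _ "w x"]) simp_all
    ultimately have "\<forall>\<^sub>F r in sequentially. v (t r * x) > 1 \<and> (\<forall>u\<in>insert w S. u (t r * x) < 1)"
      by eventually_elim simp
    then show ?thesis
      unfolding eventually_sequentially by blast
  qed
qed

lemma extensions_weak_approximation: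
  assumes "finite S" "insert v S \<subseteq> extensions r" "r y > 1" "v \<notin> S" "e > 0"
  shows "\<exists>\<theta>. v (\<theta> - 1) < e \<and> (\<forall>w\<in>S. w \<theta> < e)"
proof -
  have vf: "valued_field u" if "u \<in> insert v S" for u
    using assms(2) that by (auto simp: extensions_def valued_field_def)
  obtain z where z: "v z > 1" "\<And>w. w \<in> S \<Longrightarrow> w z < 1"
    using extensions_separate[OF assms(1-4)] by blast
  have "\<forall>\<^sub>F n in sequentially. v (z ^ n / (1 + z ^ n) - 1) < e"
    using valued_field.tendsto_power_div_one_plus_gt1[OF vf[of v] z(1)] assms(5)
    by (intro order_tendstoD(2)) simp_all
  moreover have "\<forall>\<^sub>F n in sequentially. w (z ^ n / (1 + z ^ n)) < e" if "w \<in> S" for w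
    using valued_field.tendsto_power_div_one_plus_lt1[OF vf[of w] z(2)[OF that]] that assms(5)
    by (intro order_tendstoD(2)) simp_all
  then have "\<forall>\<^sub>F n in sequentially. \<forall>w\<in>S. w (z ^ n / (1 + z ^ n)) < e"
    using assms(1) by (simp add: eventually_ball_finite)
  ultimately have "\<forall>\<^sub>F n in sequentially.
      v (z ^ n / (1 + z ^ n) - 1) < e \<and> (\<forall>w\<in>S. w (z ^ n / (1 + z ^ n)) < e)"
    by eventually_elim simp
  then show ?thesis
    unfolding eventually_sequentially by blast
qed

section \<open>The sum of the local degrees\<close>

lemma vector_space_rat: "vector_space (\<lambda>(q::rat) (x::'a::field_char_0). of_rat q * x)"
  by unfold_locales (simp_all add: algebra_simps of_rat_add of_rat_mult)

lemma card_le_field_degree: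
  fixes \<alpha> :: "'i \<Rightarrow> 'a::field_char_0"
  assumes "number_field TYPE('a)" "finite I"
    and indep: "\<And>q i. (\<Sum>i\<in>I. of_rat (q i) * \<alpha> i) = 0 \<Longrightarrow> i \<in> I \<Longrightarrow> q i = 0"
  shows "card I \<le> field_degree TYPE('a)"
proof -
  interpret vector_space "\<lambda>(q::rat) (x::'a). of_rat q * x"
    by (rule vector_space_rat)
  have inj: "inj_on \<alpha> I"
  proof (rule inj_onI, rule ccontr)
    fix i j assume ij: "i \<in> I" "j \<in> I" "\<alpha> i = \<alpha> j" "i \<noteq> j"
    define q :: "'i \<Rightarrow> rat" where "q = (\<lambda>k. if k = i then 1 else if k = j then - 1 else 0)"
    have "(\<Sum>k\<in>I. of_rat (q k) * \<alpha> k) = (\<Sum>k\<in>{i, j}. of_rat (q k) * \<alpha> k)"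
      using ij assms(2) by (intro sum.mono_neutral_right) (auto simp: q_def)
    also have "\<dots> = 0"
      using ij by (simp add: q_def of_rat_minus)
    finally show False
      using indep[of q i] ij(1) by (simp add: q_def)
  qed
  have "independent (\<alpha> ` I)"
  proof (rule independent_if_scalars_zero)
    fix f x assume "(\<Sum>x\<in>\<alpha> ` I. of_rat (f x) * x) = 0" "x \<in> \<alpha> ` I"
    then show "f x = 0"
      using indep[of "\<lambda>i. f (\<alpha> i)"] inj by (auto simp: sum.reindex)
  qed (simp add: assms(2))
  moreover obtain B where "finite B" "span B = UNIV"
    using assms(1) unfolding number_field_def by blast
  moreover obtain C where C: "independent C" "span C = UNIV" "card C = dim UNIV"
    using basis_exists[of UNIV] by (metis top.extremum_uniqueI)
  ultimately have "finite C" "card (\<alpha> ` I) \<le> card C"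
    using independent_span_bound[of B C] independent_span_bound[of C "\<alpha> ` I"] by auto
  then show ?thesis
    using C(3) inj by (simp add: field_degree_def card_image)
qed

text \<open>The elements \<open>a v k\<close> of each place are multiplied by some
  \<open>\<theta> v\<close>, close to 1 at \<open>v\<close> and to 0 at the other places. The union
  of these families is independent over the rationals: at the place owning a coefficient of largest
  value, the other blocks only perturb a sum that has a lower bound. The number \<open>n v\<close>
  is left free because finiteness of the set of places, finiteness of the local degrees and the
  final bound use different choices.\<close>

lemma sum_extensions_le_field_degree:
  fixes S :: "('a::field_char_0 \<Rightarrow> real) set"
  assumes nf: "number_field TYPE('a)" and S: "finite S" "S \<subseteq> extensions r" and y: "r y > 1"
    and a: "\<And>v. v \<in> S \<Longrightarrow> \<exists>a. \<exists>c>0. \<forall>q. \<forall>k<n v.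
      c * v (of_rat (q k)) \<le> v (\<Sum>k<n v. of_rat (q k) * a k)"
  shows "(\<Sum>v\<in>S. n v) \<le> field_degree TYPE('a)"
proof -
  have vf: "valued_field v" if "v \<in> S" for v
    using S(2) that by (auto simp: extensions_def valued_field_def)
  have res: "v (of_rat q) = r q" if "v \<in> S" for v q
    using S(2) that by (auto simp: extensions_def)
  have "\<forall>v\<in>S. \<exists>b. fst b > (0::real) \<and> (\<forall>q. \<forall>k<n v.
      fst b * v (of_rat (q k)) \<le> v (\<Sum>k<n v. of_rat (q k) * snd b k))"
    using a by fastforce
  then obtain b where b: "\<And>v. v \<in> S \<Longrightarrow> fst (b v) > (0::real)"
      "\<And>v q k. v \<in> S \<Longrightarrow> k < n v \<Longrightarrow>
        fst (b v) * v (of_rat (q k)) \<le> v (\<Sum>k<n v. of_rat (q k) * snd (b v) k)"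
    by metis
  define a where "a v = snd (b v)" for v
  define c where "c = Min (insert 1 ((\<lambda>v. fst (b v)) ` S))"
  have "c > 0"
    unfolding c_def using S(1) b(1) by (subst Min_gr_iff) auto
  have c: "c * v (of_rat (q k)) \<le> v (\<Sum>k<n v. of_rat (q k) * a v k)" if "v \<in> S" "k < n v" for v q k
  proof -
    have "c \<le> fst (b v)"
      unfolding c_def using S(1) that by (intro Min_le) auto
    then have "c * v (of_rat (q k)) \<le> fst (b v) * v (of_rat (q k))"
      using valued_field.ge_0[OF vf[OF that(1)]] by (intro mult_right_mono) auto
    then show ?thesis
      using b(2)[OF that, of q] by (simp add: a_def)
  qed
  define I where "I = Sigma S (\<lambda>v. {..<n v})"
  have "finite I"
    using S(1) by (simp add: I_def)
  have nonneg: "0 \<le> (\<Sum>i\<in>I. w (a (fst i) (snd i)))" if "w \<in> S" for w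
    using valued_field.ge_0[OF vf[OF that]] by (simp add: sum_nonneg)
  define A where "A = 1 + (\<Sum>w\<in>S. \<Sum>i\<in>I. w (a (fst i) (snd i)))"
  have A: "(\<Sum>i\<in>I. w (a (fst i) (snd i))) < A" if "w \<in> S" for w
  proof -
    have "(\<Sum>i\<in>I. w (a (fst i) (snd i))) \<le> (\<Sum>w\<in>S. \<Sum>i\<in>I. w (a (fst i) (snd i)))"
      using that S(1) nonneg
      by (intro member_le_sum[of w S "\<lambda>w. \<Sum>i\<in>I. w (a (fst i) (snd i))"]) auto
    then show ?thesis
      by (simp add: A_def)
  qed
  have "A > 0"
    unfolding A_def using nonneg by (intro add_pos_nonneg sum_nonneg[of S]) auto
  \<comment> \<open>Measured against the largest coefficient, the total perturbation will be at most
    \<open>e\<close> times a sum below \<open>A\<close>, hence below \<open>c\<close>.\<close>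
  define e where "e = c / A"
  have "e > 0"
    using \<open>c > 0\<close> \<open>A > 0\<close> by (simp add: e_def)
  have "\<exists>\<theta>. v (\<theta> - 1) < e \<and> (\<forall>w\<in>S - {v}. w \<theta> < e)" if "v \<in> S" for v
    using that S \<open>e > 0\<close> y by (intro extensions_weak_approximation) auto
  then obtain \<theta> where \<theta>: "\<And>v. v \<in> S \<Longrightarrow> v (\<theta> v - 1) < e"
      "\<And>v w. v \<in> S \<Longrightarrow> w \<in> S \<Longrightarrow> w \<noteq> v \<Longrightarrow> w (\<theta> v) < e"
    by (metis DiffI singletonD)
  define \<alpha> where "\<alpha> i = \<theta> (fst i) * a (fst i) (snd i)" for i
  have "card I \<le> field_degree TYPE('a)"
  proof (rule card_le_field_degree[OF nf \<open>finite I\<close>, of \<alpha>], rule ccontr)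
    fix q i assume zero: "(\<Sum>i\<in>I. of_rat (q i) * \<alpha> i) = 0" and i: "i \<in> I" "q i \<noteq> 0"
    \<comment> \<open>The common restriction \<open>r\<close> makes the sizes of the coefficients
      comparable across places.\<close>
    have "Max ((\<lambda>i. r (q i)) ` I) \<in> (\<lambda>i. r (q i)) ` I"
      using \<open>finite I\<close> i(1) by (intro Max_in) auto
    then obtain j where "j \<in> I" "r (q j) = Max ((\<lambda>i. r (q i)) ` I)"
      by auto
    then have j: "j \<in> I" "\<And>i. i \<in> I \<Longrightarrow> r (q i) \<le> r (q j)"
      using \<open>finite I\<close> by simp_all
    define w where "w = fst j"
    have w: "w \<in> S" "snd j < n w" "j = (w, snd j)"
      using j(1) by (auto simp: I_def w_def)
    interpret w: valued_field w
      by (rule vf[OF w(1)])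
    have "0 < r (q i)"
      using i(2) res[OF w(1), of "q i"] w.pos_iff[of "of_rat (q i)"] by simp
    then have pos: "r (q j) > 0"
      using j(2)[OF i(1)] by simp
    \<comment> \<open>The exact indicator of \<open>w\<close>, of which \<open>\<theta>\<close> is
      the approximation: subtracting the vanishing sum isolates the block of
      \<open>w\<close>.\<close>
    define \<delta> where "\<delta> v = (if v = w then 1 else 0 :: 'a)" for v
    have small: "w (\<delta> (fst i) - \<theta> (fst i)) \<le> e" if "i \<in> I" for i
      using that \<theta> w(1) w.minus_commute[of 1 "\<theta> w"]
      by (cases "fst i = w") (auto simp: I_def \<delta>_def intro!: less_imp_le)
    have "(\<Sum>i\<in>I. of_rat (q i) * (\<delta> (fst i) * a (fst i) (snd i))) =
        (\<Sum>v\<in>S. \<Sum>k<n v. of_rat (q (v, k)) * (\<delta> v * a v k))"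
      unfolding I_def by (subst sum.Sigma) (auto simp: S(1) case_prod_beta)
    also have "\<dots> = (\<Sum>v\<in>S. if v = w then \<Sum>k<n v. of_rat (q (v, k)) * a v k else 0)"
      by (intro sum.cong) (auto simp: \<delta>_def)
    also have "\<dots> = (\<Sum>k<n w. of_rat (q (w, k)) * a w k)"
      using S(1) w(1) by simp
    finally have w_part: "(\<Sum>k<n w. of_rat (q (w, k)) * a w k) =
        (\<Sum>i\<in>I. of_rat (q i) * (\<delta> (fst i) * a (fst i) (snd i))) - (\<Sum>i\<in>I. of_rat (q i) * \<alpha> i)"
      by (simp add: zero)
    also have "\<dots> = (\<Sum>i\<in>I. of_rat (q i) * ((\<delta> (fst i) - \<theta> (fst i)) * a (fst i) (snd i)))"
      by (simp add: \<alpha>_def sum_subtractf algebra_simps)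
    finally have "w (\<Sum>k<n w. of_rat (q (w, k)) * a w k) \<le>
        (\<Sum>i\<in>I. w (of_rat (q i) * ((\<delta> (fst i) - \<theta> (fst i)) * a (fst i) (snd i))))"
      using w.sum_le by simp
    also have "\<dots> \<le> (\<Sum>i\<in>I. r (q j) * (e * w (a (fst i) (snd i))))"
      using j(2) small pos \<open>e > 0\<close>
      by (intro sum_mono) (auto simp: w.mult res[OF w(1)] intro!: mult_mono)
    also have "\<dots> = r (q j) * e * (\<Sum>i\<in>I. w (a (fst i) (snd i)))"
      by (simp add: sum_distrib_left mult.assoc)
    also have "\<dots> < r (q j) * e * A"
      using A[OF w(1)] pos \<open>e > 0\<close> by (intro mult_strict_left_mono) auto
    also have "\<dots> = c * w (of_rat (q (w, snd j)))"
      using \<open>A > 0\<close> w(3) by (simp add: e_def res[OF w(1)])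
    also have "\<dots> \<le> w (\<Sum>k<n w. of_rat (q (w, k)) * a w k)"
      using c[OF w(1,2), of "\<lambda>k. q (w, k)"] .
    finally show False
      by simp
  qed
  then show ?thesis
    using S(1) by (simp add: I_def)
qed

text \<open>With the single vector 1 at each place, the preceding bound limits the size of every
  finite set of extensions.\<close>

lemma extensions_finite:
  assumes "number_field TYPE('a::field_char_0)" "r y > 1"
  shows "finite (extensions r :: ('a \<Rightarrow> real) set)"
proof -
  have "card S \<le> field_degree TYPE('a)" if "S \<subseteq> extensions r" "finite S" for S :: "('a \<Rightarrow> real) set"
  proof -
    have "(\<Sum>v\<in>S. 1) \<le> field_degree TYPE('a)"
    proof (rule sum_extensions_le_field_degree[OF assms(1) that(2,1) assms(2)])
      fix v assume "v \<in> S"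
      show "\<exists>a. \<exists>c>0. \<forall>q. \<forall>k<1::nat. c * v (of_rat (q k)) \<le> v (\<Sum>k<1::nat. of_rat (q k) * a k)"
        by (intro exI[of _ "\<lambda>k. 1"] exI[of _ 1]) simp
    qed
    then show ?thesis
      by simp
  qed
  then show ?thesis
    using finite_if_finite_subsets_card_bdd by blast
qed

text \<open>\<open>ring.dim\<close> is only meaningful once some dimension exists. By the bound
  there is an independent list of greatest length, and it must span.\<close>

lemma (in valued_field) local_degree_independent:
  assumes bound: "\<And>Us. completion.independent (rat_completion v) Us \<Longrightarrow> length Us \<le> b"
  shows "\<exists>Us. completion.independent (rat_completion v) Us \<and> length Us = local_degree v"
proof -
  define P where "P m \<longleftrightarrow> (\<exists>Us. completion.independent (rat_completion v) Us \<and> length Us = m)" for m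
  have "P 0"
    by (auto simp: P_def)
  moreover have "m \<le> b" if "P m" for m
    using that bound by (auto simp: P_def)
  ultimately obtain n where n: "P n" "\<And>m. P m \<Longrightarrow> m \<le> n"
    using GreatestI_nat[of P 0 b] Greatest_le_nat[of P _ b] by metis
  then obtain Us where Us: "completion.independent (rat_completion v) Us" "length Us = n"
    by (auto simp: P_def)
  have carrier: "set Us \<subseteq> carrier (completion v)"
    using completion.independent_in_carrier[OF Us(1)] .
  have "completion.Span (rat_completion v) Us = carrier (completion v)"
  proof (rule equalityI[OF completion.Span_subgroup_props(1)[OF rat_completion_subfield carrier]],
      rule subsetI, rule ccontr)
    fix u assume "u \<in> carrier (completion v)" "u \<notin> completion.Span (rat_completion v) Us"
    then have "completion.independent (rat_completion v) (u # Us)"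
      using Us(1) by (rule completion.li_Cons)
    then have "P (Suc n)"
      using Us(2) by (auto simp: P_def intro!: exI[of _ "u # Us"])
    then show False
      using n(2) by fastforce
  qed
  then have "completion.dimension n (rat_completion v) (carrier (completion v))"
    using completion.dimensionI[OF rat_completion_subfield Us(1)] Us(2) by simp
  then have "local_degree v = n"
    using completion.dimI[OF rat_completion_subfield] unfolding local_degree_def over_def by simp
  then show ?thesis
    using Us by auto
qed

theorem sum_local_degree_le:
  assumes nf: "number_field TYPE('a::field_char_0)" and y: "r y > 1"
    and S: "S \<subseteq> (extensions r :: ('a \<Rightarrow> real) set)"
  shows "(\<Sum>v\<in>S. local_degree v) \<le> field_degree TYPE('a)"
proof (rule sum_extensions_le_field_degree[OF nf _ S y])
  show "finite S"
    using extensions_finite[OF nf, of r y] y S finite_subset by blast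
next
  fix v assume v: "v \<in> S"
  interpret valued_field v
    using S v by (auto simp: extensions_def valued_field_def)
  \<comment> \<open>The set \<open>{v}\<close> alone already bounds all independent lists at
    \<open>v\<close>, which is what makes the local degree an actual dimension.\<close>
  have "length Us \<le> field_degree TYPE('a)"
    if "completion.independent (rat_completion v) Us" for Us
    using sum_extensions_le_field_degree[OF nf, of "{v}" r y "\<lambda>_. length Us"] S v y
      independent_elements_lower_bound[OF that] by auto
  then obtain Us where Us: "completion.independent (rat_completion v) Us"
      "length Us = local_degree v"
    using local_degree_independent by blast
  show "\<exists>a. \<exists>c>0. \<forall>q. \<forall>k<local_degree v.
      c * v (of_rat (q k)) \<le> v (\<Sum>k<local_degree v. of_rat (q k) * a k)"
    using independent_elements_lower_bound[OF Us(1)] unfolding Us(2) .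
qed

section \<open>Weights of the places\<close>

abbreviation archimedean_places :: "('a::field_char_0 \<Rightarrow> real) set" where
  "archimedean_places \<equiv> {v. archimedean_place v}"

abbreviation nonarchimedean_places :: "('a::field_char_0 \<Rightarrow> real) set" where
  "nonarchimedean_places \<equiv> {v. \<exists>p::nat. Factorial_Ring.prime p \<and> nonarchimedean_place_over p v}"

abbreviation place_weight :: "('a::field_char_0 \<Rightarrow> real) \<Rightarrow> real" where
  "place_weight v \<equiv> real (local_degree v) / real (field_degree TYPE('a))"

section \<open>Integers and ultrametric sums at a nonarchimedean place\<close>

locale nonarch_valued_field = valued_field v
  for v :: "'a::field_char_0 \<Rightarrow> real" and p :: nat +
  assumes prime_p: "Factorial_Ring.prime p"
    and add_le_max: "\<And>x y. v (x + y) \<le> max (v x) (v y)"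
    and v_p: "v (of_nat p) = 1 / real p"
begin

lemma p_gt_1: "real p > 1"
  using prime_gt_1_nat[OF prime_p] by simp

lemma of_nat_le_1: "v (of_nat n) \<le> 1"
proof (induction n)
  case (Suc n)
  then show ?case
    using add_le_max[of 1 "of_nat n"] by simp
qed simp

lemma of_int_eq_of_nat: "v (of_int n) = v (of_nat (nat \<bar>n\<bar>))"
  using minus[of "of_int n"] by (cases "n \<ge> 0") (simp_all add: of_nat_nat)

lemma of_int_le_1: "v (of_int n) \<le> 1"
  unfolding of_int_eq_of_nat by (rule of_nat_le_1)

text \<open>In a Bezout relation a p + b n = 1 the first term has value less than 1, so the second
  must have value at least 1.\<close>

lemma of_nat_eq_1:
  assumes "\<not> p dvd n"
  shows "v (of_nat n) = 1"
proof -
  have "coprime p n"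
    using prime_p assms by (simp add: prime_imp_coprime)
  then obtain a b where "a * int p + b * int n = 1"
    using bezout_int[of "int p" "int n"] by auto
  then have "of_int a * of_nat p + of_int b * of_nat n = (1 :: 'a)"
    by (metis of_int_1 of_int_add of_int_mult of_int_of_nat_eq)
  then have "1 \<le> max (v (of_int a) * (1 / real p)) (v (of_int b) * v (of_nat n))"
    using add_le_max[of "of_int a * of_nat p" "of_int b * of_nat n"] by (simp add: mult v_p)
  moreover have "v (of_int a) * (1 / real p) < 1"
    using of_int_le_1[of a] p_gt_1 by (simp add: divide_less_eq)
  moreover have "v (of_int b) * v (of_nat n) \<le> v (of_nat n)"
    using of_int_le_1[of b] by (simp add: mult_left_le_one_le)
  ultimately show ?thesis
    using of_nat_le_1[of n] by linarith
qed

lemma of_nat_eq_multiplicity: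
  assumes "n > 0"
  shows "v (of_nat n) = (1 / real p) ^ multiplicity p n"
proof -
  have "\<not> is_unit p"
    using prime_p not_prime_unit by blast
  then obtain m where m: "n = p ^ multiplicity p n * m" "\<not> p dvd m"
    using multiplicity_decompose'[of n p] assms by auto
  have "v (of_nat n) = v (of_nat (p ^ multiplicity p n * m))"
    using m(1) by simp
  then show ?thesis
    using of_nat_eq_1[OF m(2)] by (simp add: mult power v_p)
qed

lemma sum_le_bound:
  assumes "b \<ge> 0" "\<And>i. i \<in> S \<Longrightarrow> v (f i) \<le> b"
  shows "v (sum f S) \<le> b"
  using assms
proof (induction S rule: infinite_finite_induct)
  case (insert i S)
  then have "max (v (f i)) (v (sum f S)) \<le> b"
    by simp
  from order.trans[OF add_le_max this] show ?case
    using insert.hyps by simp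
qed simp_all

end

lemma nonarch_valued_fieldI:
  "Factorial_Ring.prime p \<Longrightarrow> nonarchimedean_place_over p v \<Longrightarrow> nonarch_valued_field v p"
  by unfold_locales (auto simp: nonarchimedean_place_over_def)

text \<open>The ultrametric inequality and the value at \<open>p\<close> leave only the p-adic
  absolute value on the rationals. Hence all places over \<open>p\<close> lie in one set
  \<open>extensions r\<close>.\<close>

lemma nonarchimedean_place_of_rat:
  assumes "Factorial_Ring.prime p" "nonarchimedean_place_over p v" "nonarchimedean_place_over p w"
  shows "v (of_rat q) = w (of_rat q)"
proof -
  interpret v: nonarch_valued_field v p
    using assms by (intro nonarch_valued_fieldI)
  interpret w: nonarch_valued_field w p
    using assms by (intro nonarch_valued_fieldI)
  have int: "v (of_int n) = w (of_int n)" for n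
    by (cases "n = 0")
      (simp_all add: v.of_int_eq_of_nat w.of_int_eq_of_nat v.of_nat_eq_multiplicity
        w.of_nat_eq_multiplicity del: of_nat_nat)
  obtain a b where "q = of_int a / of_int b"
    by (metis quotient_of_div surj_pair)
  then show ?thesis
    by (simp add: of_rat_divide v.divide w.divide int)
qed

lemma places_over_prime_subset_extensions:
  assumes "Factorial_Ring.prime p"
  obtains r y where "r y > 1"
    "{v. nonarchimedean_place_over p v} \<subseteq> (extensions r :: ('a::field_char_0 \<Rightarrow> real) set)"
proof (cases "{v :: 'a \<Rightarrow> real. nonarchimedean_place_over p v} = {}")
  \<comment> \<open>With no place over \<open>p\<close>, any \<open>r\<close> that exceeds 1
    somewhere will do.\<close>
  case True
  then show thesis
    using that[of "\<lambda>q. 2" 0] by simp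
next
  case False
  then obtain w :: "'a \<Rightarrow> real" where w: "nonarchimedean_place_over p w"
    by blast
  interpret w: nonarch_valued_field w p
    using assms w by (rule nonarch_valued_fieldI)
  show thesis
  proof (rule that[of "\<lambda>q. w (of_rat q)" "1 / of_nat p"])
    show "w (of_rat (1 / of_nat p)) > 1"
      using w.p_gt_1 by (simp add: of_rat_divide w.divide w.v_p)
    show "{v :: 'a \<Rightarrow> real. nonarchimedean_place_over p v} \<subseteq> extensions (\<lambda>q. w (of_rat q))"
      using nonarchimedean_place_of_rat[OF assms _ w]
      by (auto simp: extensions_def nonarchimedean_place_over_def)
  qed
qed

section \<open>Total weights and the product formula as an inequality\<close>

lemma archimedean_places_eq: "archimedean_places = extensions (\<lambda>q. real_of_rat \<bar>q\<bar>)"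
  by (simp add: archimedean_place_def extensions_def)

lemma sum_place_weight_le_1:
  assumes nf: "number_field TYPE('a::field_char_0)" and y: "r y > 1"
    and S: "S \<subseteq> (extensions r :: ('a \<Rightarrow> real) set)"
  shows "(\<Sum>v\<in>S. place_weight v) \<le> 1"
proof -
  have "real (\<Sum>v\<in>S. local_degree v) \<le> real (field_degree TYPE('a))"
    using sum_local_degree_le[OF nf y S] by (simp only: of_nat_le_iff)
  then show ?thesis
    unfolding sum_divide_distrib[symmetric] by (auto simp: divide_le_eq_1)
qed

lemma finite_archimedean_places:
  "number_field TYPE('a::field_char_0) \<Longrightarrow> finite (archimedean_places :: ('a \<Rightarrow> real) set)"
  unfolding archimedean_places_eq
  by (rule extensions_finite[where r = "\<lambda>q. real_of_rat \<bar>q\<bar>" and y = 2]) simp_all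

lemma sum_archimedean_weight_le_1:
  "number_field TYPE('a::field_char_0) \<Longrightarrow>
    (\<Sum>v\<in>(archimedean_places :: ('a \<Rightarrow> real) set). place_weight v) \<le> 1"
  unfolding archimedean_places_eq
  by (rule sum_place_weight_le_1[where r = "\<lambda>q. real_of_rat \<bar>q\<bar>" and y = 2]) simp_all

text \<open>Half of the product formula for the integer \<open>n\<close>. Both sides turn products
  into sums, which reduces the claim to a prime \<open>p\<close>: only the places over
  \<open>p\<close> contribute, each its weight times \<open>ln p\<close>, and these weights add up
  to at most 1.\<close>

lemma infsum_nonarchimedean_ln_le:
  assumes nf: "number_field TYPE('a::field_char_0)" and "n > 0"
  defines "f \<equiv> \<lambda>n (v::'a \<Rightarrow> real). place_weight v * - ln (v (of_nat n))"
  shows "f n summable_on nonarchimedean_places \<and> infsum (f n) nonarchimedean_places \<le> ln (real n)"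
proof -
  have prime: "f p summable_on nonarchimedean_places \<and>
      infsum (f p) nonarchimedean_places \<le> ln (real p)" if p: "Factorial_Ring.prime p" for p
  proof -
    define S :: "('a \<Rightarrow> real) set" where "S = {v. nonarchimedean_place_over p v}"
    obtain r y where ry: "r y > 1" "S \<subseteq> extensions r"
      using places_over_prime_subset_extensions[OF p] unfolding S_def by metis
    have "finite S"
      using extensions_finite[OF nf, of r y] ry finite_subset by blast
    have zero: "f p v = 0" if v: "v \<in> nonarchimedean_places" "v \<notin> S" for v
    proof -
      obtain q where q: "Factorial_Ring.prime q" "nonarchimedean_place_over q v"
        using v(1) by blast
      then interpret nonarch_valued_field v q
        by (rule nonarch_valued_fieldI)
      have "p \<noteq> q"
        using v(2) q(2) by (auto simp: S_def)
      then have "v (of_nat p) = 1"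
        using p q(1) primes_dvd_imp_eq by (intro of_nat_eq_1) blast
      then show ?thesis
        by (simp add: f_def)
    qed
    have f_S: "f p v = place_weight v * ln (real p)" if "v \<in> S" for v
      using that prime_gt_0_nat[OF p]
      by (simp add: f_def S_def nonarchimedean_place_over_def ln_div)
    have "S \<subseteq> nonarchimedean_places"
      using p by (auto simp: S_def)
    then have neutral: "f p summable_on nonarchimedean_places \<longleftrightarrow> f p summable_on S"
      "infsum (f p) nonarchimedean_places = infsum (f p) S"
      by (intro summable_on_cong_neutral infsum_cong_neutral; use zero in auto)+
    have "sum (f p) S = (\<Sum>v\<in>S. place_weight v) * ln (real p)"
      by (simp add: f_S sum_distrib_right)
    also have "\<dots> \<le> 1 * ln (real p)"
      using prime_ge_1_nat[OF p] sum_place_weight_le_1[OF nf, of r y S] ry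
      by (intro mult_right_mono) simp_all
    finally show ?thesis
      using \<open>finite S\<close> by (simp add: neutral)
  qed
  \<comment> \<open>Positivity is made a premise because the induction over prime factors also has a
    case for 0.\<close>
  have "n > 0 \<longrightarrow> ?thesis"
  proof (induction n rule: prime_divisors_induct)
    case (unit n)
    have zero: "f n v = 0" if v: "v \<in> nonarchimedean_places" for v
    proof -
      interpret valued_field v
        using v by unfold_locales (auto simp: nonarchimedean_place_over_def)
      show ?thesis
        using unit by (simp add: f_def)
    qed
    have "infsum (f n) nonarchimedean_places = infsum (\<lambda>v::'a \<Rightarrow> real. 0) nonarchimedean_places"
      by (rule infsum_cong) (rule zero)
    moreover have "f n summable_on nonarchimedean_places \<longleftrightarrow>
        (\<lambda>v::'a \<Rightarrow> real. 0 :: real) summable_on nonarchimedean_places"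
      by (rule summable_on_cong) (rule zero)
    ultimately show ?case
      using unit by simp
  next
    case (factor p n)
    show ?case
    proof
      assume pos: "p * n > 0"
      have mult: "f (p * n) v = f p v + f n v" if v: "v \<in> nonarchimedean_places" for v
      proof -
        interpret valued_field v
          using v by unfold_locales (auto simp: nonarchimedean_place_over_def)
        show ?thesis
          using pos by (simp add: f_def mult ln_mult algebra_simps add_divide_distrib)
      qed
      have "infsum (f (p * n)) nonarchimedean_places = infsum (\<lambda>v. f p v + f n v) nonarchimedean_places"
        by (rule infsum_cong) (rule mult)
      moreover have "f (p * n) summable_on nonarchimedean_places \<longleftrightarrow>
          (\<lambda>v. f p v + f n v) summable_on nonarchimedean_places"
        by (rule summable_on_cong) (rule mult)
      moreover have "p > 0" "n > 0"
        using pos by simp_all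
      ultimately show "f (p * n) summable_on nonarchimedean_places \<and>
          infsum (f (p * n)) nonarchimedean_places \<le> ln (real (p * n))"
        using factor prime[of p] by (simp add: infsum_add summable_on_add ln_mult)
    qed
  qed simp
  then show ?thesis
    using \<open>n > 0\<close> by blast
qed

section \<open>Interpolation at integer points\<close>

text \<open>Both sides have degree at most \<open>d\<close> and agree at \<open>d + 1\<close>
  points.\<close>

lemma lagrange_interpolation:
  fixes F :: "'a::field poly"
  assumes "finite I" "card I = d + 1" "inj_on y I" "degree F \<le> d"
  shows "F = (\<Sum>i\<in>I. Polynomial.smult (poly F (y i) / (\<Prod>j\<in>I - {i}. y i - y j))
    (\<Prod>j\<in>I - {i}. [:- y j, 1:]))" (is "F = ?G")
proof (rule poly_eqI_degree[of "y ` I"])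
  fix z assume "z \<in> y ` I"
  then obtain i where i: "i \<in> I" "z = y i"
    by blast
  have zero: "(\<Prod>j\<in>I - {k}. y i - y j) = 0" if "k \<in> I" "k \<noteq> i" for k
    using that i assms(1) by (intro prod_zero) auto
  have nz: "(\<Prod>j\<in>I - {i}. y i - y j) \<noteq> 0"
    using i assms(1,3) by (auto simp: inj_on_def)
  have "poly ?G z = (\<Sum>k\<in>I. poly F (y k) / (\<Prod>j\<in>I - {k}. y k - y j) * (\<Prod>j\<in>I - {k}. y i - y j))"
    by (simp add: poly_sum poly_prod i(2))
  also have "\<dots> = (\<Sum>k\<in>{i}. poly F (y k) / (\<Prod>j\<in>I - {k}. y k - y j) * (\<Prod>j\<in>I - {k}. y i - y j))"
    using assms(1) i(1) zero by (intro sum.mono_neutral_right) auto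
  also have "\<dots> = poly F z"
    using nz by (simp add: i(2))
  finally show "poly F z = poly ?G z"
    by simp
next
  have card: "card (y ` I) = d + 1"
    using assms by (simp add: card_image)
  then show "degree F < card (y ` I)"
    using assms(4) by simp
  have deg: "degree (\<Prod>j\<in>I - {i}. [:- y j, 1:]) \<le> d" if "i \<in> I" for i
    using degree_prod_sum_le[of "I - {i}" "\<lambda>j. [:- y j, 1:]"] assms(1,2) that by simp
  have "degree ?G \<le> d"
    using assms(1) deg by (intro degree_sum_le) (auto intro: order.trans[OF degree_smult_le])
  then show "degree ?G < card (y ` I)"
    using card by simp
qed

text \<open>Multiplying by X - y enlarges a common bound on the coefficients by a factor of at most
  \<open>1 + M\<close>.\<close>

lemma coeff_prod_linear_of_int:
  fixes y :: "'i \<Rightarrow> int"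
  assumes "finite J" "\<And>j. j \<in> J \<Longrightarrow> \<bar>y j\<bar> \<le> M"
  shows "\<exists>z::int. poly.coeff (\<Prod>j\<in>J. [:- of_int (y j), 1:] :: 'a::comm_ring_1 poly) k = of_int z \<and>
    \<bar>z\<bar> \<le> (1 + M) ^ card J"
  using assms
proof (induction J arbitrary: k rule: finite_induct)
  case empty
  show ?case
    by (intro exI[of _ "if k = 0 then 1 else 0"]) simp
next
  case (insert j J)
  define P where "P = (\<Prod>j\<in>J. [:- of_int (y j), 1:] :: 'a poly)"
  obtain z where z: "poly.coeff P k = of_int z" "\<bar>z\<bar> \<le> (1 + M) ^ card J"
    using insert unfolding P_def by blast
  obtain z' where z': "poly.coeff P (k - 1) = of_int z'" "\<bar>z'\<bar> \<le> (1 + M) ^ card J"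
    using insert unfolding P_def by blast
  \<comment> \<open>At \<open>k = 0\<close> the truncated \<open>k - 1\<close> is 0 as well, so
    \<open>z'\<close> has to be left out there.\<close>
  define u where "u = - y j * z + (if k = 0 then 0 else z')"
  have "poly.coeff ([:- of_int (y j), 1:] * P) k = of_int u"
    using z(1) z'(1) by (cases k) (simp_all add: u_def)
  moreover have "\<bar>u\<bar> \<le> (1 + M) ^ Suc (card J)"
  proof -
    have "\<bar>u\<bar> \<le> \<bar>y j\<bar> * \<bar>z\<bar> + \<bar>z'\<bar>"
      using abs_triangle_ineq4[of z' "y j * z"] by (simp add: u_def abs_mult)
    also have "\<dots> \<le> M * (1 + M) ^ card J + (1 + M) ^ card J"
      using insert.prems[of j] z(2) z'(2) by (intro add_mono mult_mono) auto
    finally show ?thesis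
      by (simp add: algebra_simps)
  qed
  ultimately show ?case
    using insert.hyps by (auto simp: P_def)
qed

text \<open>Over the whole interval without \<open>a\<close> the product is, up to sign, (a - A)! (B
  - a)!, and the quotient of (B - A)! by this is a binomial coefficient.\<close>

lemma prod_differences_dvd_fact:
  fixes a A B :: int
  assumes "J \<subseteq> {A..B} - {a}" "a \<in> {A..B}"
  shows "(\<Prod>y\<in>J. a - y) dvd fact (nat (B - A))"
proof -
  have low: "(\<Prod>y\<in>{A..<a}. a - y) = fact (nat (a - A))"
  proof -
    have "(\<Prod>y\<in>{A..<a}. a - y) = (\<Prod>n\<in>{1..nat (a - A)}. int n)"
      by (rule prod.reindex_bij_witness[of _ "\<lambda>n. a - int n" "\<lambda>y. nat (a - y)"]) auto
    then show ?thesis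
      by (simp add: fact_prod)
  qed
  have high: "(\<Prod>y\<in>{a<..B}. a - y) dvd fact (nat (B - a))"
  proof -
    have "(\<Prod>y\<in>{a<..B}. a - y) = (\<Prod>n\<in>{1..nat (B - a)}. - int n)"
      by (rule prod.reindex_bij_witness[of _ "\<lambda>n. a + int n" "\<lambda>y. nat (y - a)"]) auto
    also have "\<dots> = (- 1) ^ nat (B - a) * fact (nat (B - a))"
      using prod.distrib[of "\<lambda>n. - 1" int "{1..nat (B - a)}"] by (simp add: fact_prod)
    finally show ?thesis
      by (simp add: minus_one_power_iff)
  qed
  have "(\<Prod>y\<in>J. a - y) dvd (\<Prod>y\<in>{A..B} - {a}. a - y)"
    using assms(1) by (intro prod_dvd_prod_subset) auto
  also have "{A..B} - {a} = {A..<a} \<union> {a<..B}"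
    using assms(2) by auto
  also have "(\<Prod>y\<in>{A..<a} \<union> {a<..B}. a - y) = (\<Prod>y\<in>{A..<a}. a - y) * (\<Prod>y\<in>{a<..B}. a - y)"
    by (intro prod.union_disjoint) auto
  also have "\<dots> dvd fact (nat (a - A)) * fact (nat (B - a))"
    using high by (simp add: low mult_dvd_mono)
  also have "\<dots> dvd fact (nat (a - A) + nat (B - a))"
    by (rule fact_fact_dvd_fact)
  also have "nat (a - A) + nat (B - a) = nat (B - A)"
    using assms(2) by auto
  finally show ?thesis .
qed

text \<open>
  At most \<open>N - d - 1\<close> of the values exceed the mean over \<open>N - d\<close>, whence the factor
  \<open>N / (N - d)\<close> of the theorem.
\<close>

lemma ex_subset_le_mean:
  fixes a :: "'i \<Rightarrow> real"
  assumes "finite T" "\<And>i. i \<in> T \<Longrightarrow> 0 \<le> a i" "d < card T"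
  obtains I where "I \<subseteq> T" "card I = d + 1" "finite I"
    "\<And>i. i \<in> I \<Longrightarrow> a i \<le> (\<Sum>i\<in>T. a i) / (real (card T) - real d)"
proof -
  define t where "t = (\<Sum>i\<in>T. a i) / (real (card T) - real d)"
  define U where "U = {i\<in>T. a i > t}"
  have U: "finite U" "U \<subseteq> T"
    using assms(1) by (auto simp: U_def)
  have "t \<ge> 0"
    unfolding t_def using assms by (intro divide_nonneg_nonneg sum_nonneg) auto
  have "card U < card T - d"
  proof (rule ccontr)
    assume "\<not> card U < card T - d"
    then have card: "card T - d \<le> card U"
      by simp
    \<comment> \<open>A nonempty \<open>U\<close> makes the comparison of sums below strict.\<close>
    then have "U \<noteq> {}"
      using assms(3) by auto
    have "(\<Sum>i\<in>T. a i) = (real (card T) - real d) * t"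
      using assms(3) by (simp add: t_def)
    also have "\<dots> \<le> real (card U) * t"
      using card assms(3) \<open>t \<ge> 0\<close> by (intro mult_right_mono) linarith+
    also have "\<dots> = (\<Sum>i\<in>U. t)"
      by simp
    also have "\<dots> < (\<Sum>i\<in>U. a i)"
      using U(1) \<open>U \<noteq> {}\<close> by (intro sum_strict_mono) (auto simp: U_def)
    also have "\<dots> \<le> (\<Sum>i\<in>T. a i)"
      using U assms by (intro sum_mono2) auto
    finally show False
      by simp
  qed
  then have "d + 1 \<le> card (T - U)"
    using U by (simp add: card_Diff_subset)
  then obtain I where "I \<subseteq> T - U" "card I = d + 1" "finite I"
    using obtain_subset_with_card_n by metis
  then show thesis
    using that[of I] by (force simp: U_def t_def)
qed

section \<open>Bounds for the coefficients at a single place\<close>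

lemma (in valued_field) coeff_lagrange:
  fixes F :: "'a poly" and x :: "'i \<Rightarrow> int"
  assumes "finite I" "card I = d + 1" "inj_on x I" "degree F \<le> d" "\<And>i. i \<in> I \<Longrightarrow> \<bar>x i\<bar> \<le> M"
  obtains z where "\<And>i. i \<in> I \<Longrightarrow> \<bar>z i\<bar> \<le> (1 + M) ^ d"
    "poly.coeff F k = (\<Sum>i\<in>I. poly F (of_int (x i)) * of_int (z i) / of_int (\<Prod>j\<in>I - {i}. x i - x j))"
proof -
  define L where "L i = (\<Prod>j\<in>I - {i}. [:- of_int (x j), 1:] :: 'a poly)" for i
  \<comment> \<open>Integral numerators \<open>z i\<close> serve both kinds of places: their size
    matters at the archimedean ones, their integrality at the others.\<close>
  have "\<exists>z::int. poly.coeff (L i) k = of_int z \<and> \<bar>z\<bar> \<le> (1 + M) ^ d" if "i \<in> I" for i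
    using coeff_prod_linear_of_int[of "I - {i}" x M k, where 'a = 'a] assms that by (simp add: L_def)
  then obtain z where z: "\<And>i. i \<in> I \<Longrightarrow> poly.coeff (L i) k = of_int (z i)"
      "\<And>i. i \<in> I \<Longrightarrow> \<bar>z i\<bar> \<le> (1 + M) ^ d"
    by metis
  have "inj_on (\<lambda>i. of_int (x i) :: 'a) I"
    using assms(3) by (auto simp: inj_on_def)
  from lagrange_interpolation[OF assms(1,2) this assms(4)]
  have "poly.coeff F k = poly.coeff (\<Sum>i\<in>I. Polynomial.smult
      (poly F (of_int (x i)) / of_int (\<Prod>j\<in>I - {i}. x i - x j)) (L i)) k"
    by (simp add: L_def)
  also have "\<dots> = (\<Sum>i\<in>I. poly F (of_int (x i)) * of_int (z i) / of_int (\<Prod>j\<in>I - {i}. x i - x j))"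
    by (simp add: coeff_sum z(1))
  finally show thesis
    using that[of z] z(2) by simp
qed

text \<open>There are d + 1 summands, the denominators are nonzero integers and so at least 1 in
  absolute value, and \<open>1 + M \<le> 2 * M\<close> as \<open>M \<ge> 1\<close>.\<close>

lemma archimedean_poly_abs_le:
  fixes F :: "'a::field_char_0 poly" and x :: "'i \<Rightarrow> int"
  assumes v: "archimedean_place v"
    and I: "finite I" "card I = d + 1" "inj_on x I" "degree F \<le> d" "\<And>i. i \<in> I \<Longrightarrow> \<bar>x i\<bar> \<le> M"
    and M: "M \<ge> 1" and G: "\<And>i. i \<in> I \<Longrightarrow> v (poly F (of_int (x i))) \<le> G"
  shows "poly_abs v F \<le> G * ((real d + 1) * (2 * real_of_int M) ^ d)"
proof -
  interpret valued_field v
    using v by unfold_locales (simp add: archimedean_place_def)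
  have of_int: "v (of_int n) = real_of_int \<bar>n\<bar>" for n
    using v of_rat_of_int_eq[of n, where 'a = 'a] unfolding archimedean_place_def
    by (metis of_int_abs of_rat_of_int_eq)
  have "I \<noteq> {}"
    using I(2) by auto
  then have "G \<ge> 0"
    using G ge_0 by (meson ex_in_conv order.trans)
  have "v (poly.coeff F k) \<le> G * ((real d + 1) * (2 * real_of_int M) ^ d)" for k
  proof -
    obtain z where z: "\<And>i. i \<in> I \<Longrightarrow> \<bar>z i\<bar> \<le> (1 + M) ^ d"
      "poly.coeff F k = (\<Sum>i\<in>I. poly F (of_int (x i)) * of_int (z i) / of_int (\<Prod>j\<in>I - {i}. x i - x j))"
      using coeff_lagrange[of I d x F M k] I by blast
    have "v (poly F (of_int (x i)) * of_int (z i) / of_int (\<Prod>j\<in>I - {i}. x i - x j))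
        \<le> G * (2 * real_of_int M) ^ d" if i: "i \<in> I" for i
    proof -
      have "(\<Prod>j\<in>I - {i}. x i - x j) \<noteq> 0"
        using i I(1,3) by (auto simp: inj_on_def)
      then have den: "real_of_int \<bar>\<Prod>j\<in>I - {i}. x i - x j\<bar> \<ge> 1"
        by linarith
      have "(1 + M) ^ d \<le> (2 * M) ^ d"
        using M by (intro power_mono) auto
      then have "\<bar>z i\<bar> \<le> (2 * M) ^ d"
        using z(1)[OF i] by linarith
      then have num: "real_of_int \<bar>z i\<bar> \<le> (2 * real_of_int M) ^ d"
        by (metis of_int_le_iff of_int_mult of_int_numeral of_int_power)
      have "v (poly F (of_int (x i)) * of_int (z i) / of_int (\<Prod>j\<in>I - {i}. x i - x j)) =
          v (poly F (of_int (x i))) * real_of_int \<bar>z i\<bar> / real_of_int \<bar>\<Prod>j\<in>I - {i}. x i - x j\<bar>"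
        by (simp add: divide mult of_int del: of_int_prod of_int_abs)
      also have "\<dots> \<le> v (poly F (of_int (x i))) * real_of_int \<bar>z i\<bar> / 1"
        using den by (intro divide_left_mono) auto
      also have "\<dots> \<le> G * (2 * real_of_int M) ^ d"
        using G[OF i] num \<open>G \<ge> 0\<close> by (simp add: mult_mono)
      finally show ?thesis .
    qed
    then have "v (poly.coeff F k) \<le> (\<Sum>i\<in>I. G * (2 * real_of_int M) ^ d)"
      unfolding z(2) by (intro order.trans[OF sum_le] sum_mono)
    then show ?thesis
      using I(2) by (simp add: algebra_simps)
  qed
  then show ?thesis
    by (simp add: poly_abs_def)
qed

text \<open>The ultrametric inequality removes the number of summands and integers have value at
  most 1, so only the denominators cost something; they all divide the same factorial.\<close>

lemma nonarchimedean_poly_abs_le: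
  fixes F :: "'a::field_char_0 poly" and x :: "'i \<Rightarrow> int"
  assumes v: "Factorial_Ring.prime p" "nonarchimedean_place_over p v"
    and I: "finite I" "card I = d + 1" "inj_on x I" "degree F \<le> d" "x ` I \<subseteq> {A..B}"
    and G: "\<And>i. i \<in> I \<Longrightarrow> v (poly F (of_int (x i))) \<le> G"
  shows "poly_abs v F \<le> G / v (of_nat (fact (nat (B - A))))"
proof -
  interpret nonarch_valued_field v p
    using v by (rule nonarch_valued_fieldI)
  define f :: nat where "f = fact (nat (B - A))"
  have "v (of_nat f) > 0"
    by (simp add: f_def)
  have "I \<noteq> {}"
    using I(2) by auto
  then have "G \<ge> 0"
    using G ge_0 by (meson ex_in_conv order.trans)
  have abs: "\<bar>x i\<bar> \<le> max \<bar>A\<bar> \<bar>B\<bar>" if "i \<in> I" for i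
    using that I(5) by (force simp: abs_if)
  have "v (poly.coeff F k) \<le> G / v (of_nat f)" for k
  proof -
    obtain z :: "'i \<Rightarrow> int" where
      z: "poly.coeff F k = (\<Sum>i\<in>I. poly F (of_int (x i)) * of_int (z i) / of_int (\<Prod>j\<in>I - {i}. x i - x j))"
      using coeff_lagrange[of I d x F "max \<bar>A\<bar> \<bar>B\<bar>" k] I(1-4) abs by blast
    have "v (poly F (of_int (x i)) * of_int (z i) / of_int (\<Prod>j\<in>I - {i}. x i - x j)) \<le> G / v (of_nat f)"
      if i: "i \<in> I" for i
    proof -
      define P where "P = (\<Prod>j\<in>I - {i}. x i - x j)"
      have "P = (\<Prod>y\<in>x ` (I - {i}). x i - y)"
        unfolding P_def by (subst prod.reindex) (use I(3) in \<open>auto intro: inj_on_subset\<close>)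
      also have "\<dots> dvd fact (nat (B - A))"
        using i I(3,5) by (intro prod_differences_dvd_fact) (auto simp: inj_on_def)
      finally obtain m where m: "fact (nat (B - A)) = P * m"
        by (auto elim: dvdE)
      have "of_nat f = (of_int P * of_int m :: 'a)"
        unfolding f_def by (metis m of_int_fact of_int_mult of_nat_fact)
      then have "v (of_nat f) = v (of_int P) * v (of_int m)"
        by (simp add: mult)
      also have "\<dots> \<le> v (of_int P)"
        using of_int_le_1[of m] by (simp add: mult_left_le)
      finally have den: "v (of_nat f) \<le> v (of_int P)" .
      have "v (poly F (of_int (x i)) * of_int (z i) / of_int P) =
          v (poly F (of_int (x i))) * v (of_int (z i)) / v (of_int P)"
        by (simp add: divide mult)
      also have "\<dots> \<le> G / v (of_nat f)"
      proof (rule frac_le)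
        show "v (poly F (of_int (x i))) * v (of_int (z i)) \<le> G"
          using mult_mono[OF G[OF i] of_int_le_1[of "z i"]] \<open>G \<ge> 0\<close> by simp
      qed (use den \<open>v (of_nat f) > 0\<close> \<open>G \<ge> 0\<close> in simp_all)
      finally show ?thesis
        by (simp add: P_def)
    qed
    then show ?thesis
      unfolding z using \<open>G \<ge> 0\<close> by (intro sum_le_bound) auto
  qed
  then show ?thesis
    by (simp add: poly_abs_def f_def)
qed

text \<open>Supplies the comparison that carries summability from the height of \<open>F\<close> to
  the heights of its values.\<close>

lemma nonarchimedean_poly_le_poly_abs:
  assumes v: "Factorial_Ring.prime p" "nonarchimedean_place_over p v"
  shows "v (poly F (of_int n)) \<le> poly_abs v F"
proof -
  interpret nonarch_valued_field v p
    using v by (rule nonarch_valued_fieldI)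
  have coeff: "v (poly.coeff F k) \<le> poly_abs v F" if "k \<le> degree F" for k
    unfolding poly_abs_def using that by (intro Max_ge) auto
  have "v (poly.coeff F k * of_int n ^ k) \<le> poly_abs v F" if "k \<le> degree F" for k
  proof -
    have "v (poly.coeff F k * of_int n ^ k) \<le> v (poly.coeff F k)"
      using of_int_le_1[of n] by (simp add: mult power mult_left_le power_le_one)
    then show ?thesis
      using coeff[OF that] by linarith
  qed
  moreover have "poly_abs v F \<ge> 0"
    using coeff[of 0] ge_0 order.trans by blast
  ultimately show ?thesis
    unfolding poly_altdef by (intro sum_le_bound) auto
qed

section \<open>Summation of the local bounds over all places\<close>

theorem theorem1p1:
  fixes F :: "'a::field_char_0 poly"
    and A B D M :: int and d N :: nat and H :: real and x :: "nat \<Rightarrow> int"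
  assumes "number_field TYPE('a)"
    and "A \<le> B"
    and "D = B - A"
    and "M = max \<bar>A\<bar> \<bar>B\<bar>"
    and "d \<ge> 1"
    and "Polynomial.degree F \<le> d"
    and "N \<ge> d + 1"
    and "inj_on x {1..N}"
    and "x ` {1..N} \<subseteq> {A..B}"
    and "\<forall>i\<in>{1..N}. height (poly F (of_int (x i))) \<le> H"
  shows "poly_height F \<le>
    real N / (real N - real d) * H + real_of_int D * ln (real_of_int D)
      + real d * ln (2 * real_of_int M) + ln (real d + 1)"
proof -
  let ?AR = "archimedean_places :: ('a \<Rightarrow> real) set"
  let ?NA = "nonarchimedean_places :: ('a \<Rightarrow> real) set"
  \<comment> \<open>As \<open>d \<ge> 1\<close>, there are at least two points. They give
    \<open>D \<ge> 1\<close> and \<open>M \<ge> 1\<close>, hence nonnegative error terms.\<close>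
  have indices: "1 \<in> {1..N}" "2 \<in> {1..N}"
    using assms(5,7) by simp_all
  have "x 1 \<noteq> x 2"
    using inj_on_eq_iff[OF assms(8) indices] by simp
  moreover have "x 1 \<in> {A..B}" "x 2 \<in> {A..B}"
    using assms(9) indices by blast+
  ultimately have "A < B"
    by auto
  then have D: "D \<ge> 1" and M: "M \<ge> 1"
    using assms(3,4) by auto
  have x_le: "\<bar>x i\<bar> \<le> M" if "i \<in> {1..N}" for i
  proof -
    have "x i \<in> {A..B}"
      using assms(9) that by blast
    then show ?thesis
      using assms(4) by auto
  qed
  have places_eq: "places = ?AR \<union> ?NA"
    by (auto simp: places_def)
  have disjoint: "?AR \<inter> ?NA = {}"
  proof -
    have False if "archimedean_place v" "Factorial_Ring.prime p" "nonarchimedean_place_over p v"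
      for v :: "'a \<Rightarrow> real" and p
    proof -
      interpret nonarch_valued_field v p
        using that(2,3) by (rule nonarch_valued_fieldI)
      have "v (of_rat 2) = real_of_rat \<bar>2\<bar>"
        using that(1) unfolding archimedean_place_def by blast
      then show False
        using of_nat_le_1[of 2] by simp
    qed
    then show ?thesis
      by blast
  qed
  define C where "C = ln ((real d + 1) * (2 * real_of_int M) ^ d)"
  define f :: nat where "f = fact (nat D)"
  define g where "g i v = place_weight v * ln (max 1 (v (poly F (of_int (x i)))))"
    for i and v :: "'a \<Rightarrow> real"
  define h where "h v = place_weight v * ln (max 1 (poly_abs v F))" for v :: "'a \<Rightarrow> real"
  \<comment> \<open>The weighted local error, independent of the values of \<open>F\<close>; its sum
    is bounded separately over the two kinds of places.\<close>
  define E where "E v = place_weight v * (if v \<in> ?AR then C else - ln (v (of_nat f)))"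
    for v :: "'a \<Rightarrow> real"
  have "1 \<le> (real d + 1) * (2 * real_of_int M) ^ d"
  proof -
    have "1 * 1 \<le> (real d + 1) * (2 * real_of_int M) ^ d"
      using M by (intro mult_mono one_le_power) auto
    then show ?thesis
      by simp
  qed
  then have "C \<ge> 0"
    by (simp add: C_def)
  have C_eq: "C = real d * ln (2 * real_of_int M) + ln (real d + 1)"
    using M by (simp add: C_def ln_mult ln_realpow distrib_left)
  have g_nonneg: "g i v \<ge> 0" and h_nonneg: "h v \<ge> 0" for i v
    by (simp_all add: g_def h_def)
  have height_eq: "height (poly F (of_int (x i))) = infsum (g i) places" for i
    by (simp add: height_def g_def[abs_def])
  have poly_height_eq: "poly_height F = infsum h places"
    by (simp add: poly_height_def h_def[abs_def])
  have local: "h v \<le> 1 / (real N - real d) * (\<Sum>i\<in>{1..N}. g i v) + E v" if v: "v \<in> places" for v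
  proof -
    define a where "a i = ln (max 1 (v (poly F (of_int (x i)))))" for i
    define t where "t = (\<Sum>i\<in>{1..N}. a i) / (real N - real d)"
    obtain I where I: "I \<subseteq> {1..N}" "card I = d + 1" "finite I" "\<And>i. i \<in> I \<Longrightarrow> a i \<le> t"
      using ex_subset_le_mean[of "{1..N}" a d] assms(7) by (auto simp: a_def t_def)
    have inj: "inj_on x I"
      using assms(8) I(1) by (rule inj_on_subset)
    have range: "x ` I \<subseteq> {A..B}"
      using assms(9) I(1) by auto
    have G: "v (poly F (of_int (x i))) \<le> exp t" if "i \<in> I" for i
    proof -
      have "exp (a i) = max 1 (v (poly F (of_int (x i))))"
        unfolding a_def by (rule exp_ln) simp
      then show ?thesis
        using I(4)[OF that] exp_le_cancel_iff[of "a i" t] by linarith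
    qed
    have "t \<ge> 0"
      unfolding t_def a_def using assms(7) by (intro divide_nonneg_nonneg sum_nonneg) auto
    have "ln (max 1 (poly_abs v F)) \<le> t + (if v \<in> ?AR then C else - ln (v (of_nat f)))"
    proof (cases "v \<in> ?AR")
      case True
      define R where "R = (real d + 1) * (2 * real_of_int M) ^ d"
      have R: "R \<ge> 1"
        unfolding R_def by fact
      have "poly_abs v F \<le> exp t * R"
        unfolding R_def using True I(1) x_le M G
        by (intro archimedean_poly_abs_le[OF _ I(3,2) inj assms(6)]) auto
      moreover have "1 * 1 \<le> exp t * R"
        using \<open>t \<ge> 0\<close> R by (intro mult_mono) auto
      ultimately have "ln (max 1 (poly_abs v F)) \<le> ln (exp t * R)"
        by simp
      also have "\<dots> = t + C"
        unfolding C_def R_def[symmetric] using R ln_mult[of "exp t" R] by simp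
      finally show ?thesis
        using True by simp
    next
      case False
      then obtain p where p: "Factorial_Ring.prime p" "nonarchimedean_place_over p v"
        using v places_eq by auto
      interpret nonarch_valued_field v p
        using p by (rule nonarch_valued_fieldI)
      have f: "0 < v (of_nat f)" "v (of_nat f) \<le> 1"
        using of_nat_le_1[of f] by (simp_all add: f_def)
      have "poly_abs v F \<le> exp t / v (of_nat f)"
        unfolding f_def assms(3) using G
        by (intro nonarchimedean_poly_abs_le[OF p I(3,2) inj assms(6) range]) auto
      moreover have "1 \<le> exp t / v (of_nat f)"
        using f \<open>t \<ge> 0\<close> by (simp add: le_divide_eq) (meson one_le_exp_iff order.trans)
      ultimately have "ln (max 1 (poly_abs v F)) \<le> ln (exp t / v (of_nat f))"
        by simp
      also have "\<dots> = t - ln (v (of_nat f))"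
        using f by (simp add: ln_div)
      finally show ?thesis
        using False by simp
    qed
    then have "h v \<le> place_weight v * (t + (if v \<in> ?AR then C else - ln (v (of_nat f))))"
      unfolding h_def by (intro mult_left_mono) auto
    also have "\<dots> = 1 / (real N - real d) * (\<Sum>i\<in>{1..N}. g i v) + E v"
    proof -
      have "(\<Sum>i\<in>{1..N}. g i v) = place_weight v * (\<Sum>i\<in>{1..N}. a i)"
        by (simp only: g_def a_def sum_distrib_left)
      then show ?thesis
        unfolding E_def distrib_left by (simp add: t_def)
    qed
    finally show ?thesis .
  qed
  have E_AR: "E summable_on ?AR" "infsum E ?AR \<le> C"
  proof -
    have fin: "finite ?AR"
      using assms(1) by (rule finite_archimedean_places)
    then show "E summable_on ?AR"
      by simp
    have "infsum E ?AR = (\<Sum>v\<in>?AR. place_weight v) * C"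
      using fin by (simp add: E_def sum_distrib_right)
    also have "\<dots> \<le> 1 * C"
      using sum_archimedean_weight_le_1[OF assms(1)] \<open>C \<ge> 0\<close> by (rule mult_right_mono)
    finally show "infsum E ?AR \<le> C"
      by simp
  qed
  have E_NA: "E summable_on ?NA" "infsum E ?NA \<le> ln (real f)"
  proof -
    have E_eq: "E v = place_weight v * - ln (v (of_nat f))" if "v \<in> ?NA" for v
      using that disjoint by (auto simp: E_def)
    have "f > 0"
      by (simp add: f_def)
    note ln_le = infsum_nonarchimedean_ln_le[OF assms(1) this]
    have "E summable_on ?NA \<longleftrightarrow> (\<lambda>v. place_weight v * - ln (v (of_nat f))) summable_on ?NA"
      by (rule summable_on_cong) (rule E_eq)
    then show "E summable_on ?NA"
      using ln_le by blast
    have "infsum E ?NA = infsum (\<lambda>v. place_weight v * - ln (v (of_nat f))) ?NA"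
      by (rule infsum_cong) (rule E_eq)
    then show "infsum E ?NA \<le> ln (real f)"
      using ln_le by simp
  qed
  \<comment> \<open>The estimate of D! by D^D is the source of the term D log D.\<close>
  have "real f \<le> real (nat D) ^ nat D"
    using fact_le_power[of "nat D", where 'a = real] by (simp add: f_def)
  then have "ln (real f) \<le> ln (real (nat D) ^ nat D)"
    using D by (subst ln_le_cancel_iff) (auto simp: f_def)
  then have ln_f: "ln (real f) \<le> real_of_int D * ln (real_of_int D)"
    using D by (simp add: ln_realpow)
  have E: "E summable_on places" "infsum E places \<le> C + real_of_int D * ln (real_of_int D)"
    using E_AR E_NA disjoint ln_f unfolding places_eq
    by (auto simp: infsum_Un_disjoint intro: summable_on_Un_disjoint)
  \<comment> \<open>\<open>H\<close> bounds a height, and \<open>infsum\<close> of nonnegative terms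
    is nonnegative whether or not they are summable.\<close>
  have H: "0 \<le> H"
  proof -
    have "0 \<le> infsum (g 1) places"
      by (rule infsum_nonneg) (rule g_nonneg)
    also have "\<dots> \<le> H"
      unfolding height_eq[symmetric] using assms(10) indices(1) by blast
    finally show ?thesis .
  qed
  have "poly_height F \<le> real N / (real N - real d) * H + (C + real_of_int D * ln (real_of_int D))"
  proof (cases "h summable_on places")
    case False
    \<comment> \<open>The height of \<open>F\<close> then has the junk value 0, so its finiteness need not be proved.\<close>
    have "0 \<le> real N / (real N - real d) * H"
      using H assms(7) by simp
    moreover have "0 \<le> real_of_int D * ln (real_of_int D)"
      using D by simp
    ultimately show ?thesis
      using False \<open>C \<ge> 0\<close> by (simp add: poly_height_eq infsum_not_exists)
  next
    case True
    \<comment> \<open>Without summability \<open>height\<close> would be 0 and its bound would say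
      nothing about the \<open>g i\<close>. At nonarchimedean places \<open>h\<close> dominates, and
      the archimedean places are finite in number.\<close>
    have g_sum: "g i summable_on places" for i
    proof -
      have "h summable_on ?NA"
        using True by (rule summable_on_subset_banach) (auto simp: places_eq)
      moreover have "g i v \<le> h v" if "v \<in> ?NA" for v
      proof -
        have "v (poly F (of_int (x i))) \<le> poly_abs v F"
          using that nonarchimedean_poly_le_poly_abs by blast
        then show ?thesis
          unfolding g_def h_def by (intro mult_left_mono) auto
      qed
      then have "norm (g i v) \<le> norm (h v)" if "v \<in> ?NA" for v
        using that by (simp only: real_norm_def abs_of_nonneg[OF g_nonneg] abs_of_nonneg[OF h_nonneg])
      moreover have "norm (g i v) = g i v" "norm (h v) = h v" for v
        by (simp_all add: g_nonneg h_nonneg)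
      ultimately have "g i summable_on ?NA"
        using Infinite_Sum.abs_summable_on_comparison_test[of h ?NA "g i"] by simp
      moreover have "g i summable_on ?AR"
        using finite_archimedean_places[OF assms(1)] by simp
      ultimately show ?thesis
        unfolding places_eq using disjoint by (intro summable_on_Un_disjoint)
    qed
    have sum: "(\<lambda>v. \<Sum>i\<in>J. g i v) summable_on places \<and>
        infsum (\<lambda>v. \<Sum>i\<in>J. g i v) places = (\<Sum>i\<in>J. infsum (g i) places)" if "finite J" for J
      using that by induction (simp_all add: g_sum summable_on_add infsum_add)
    define S where "S v = 1 / (real N - real d) * (\<Sum>i\<in>{1..N}. g i v)" for v
    have S: "S summable_on places"
      unfolding S_def[abs_def] using sum[of "{1..N}"] by (intro summable_on_cmult_right) simp
    have "infsum S places = 1 / (real N - real d) * (\<Sum>i\<in>{1..N}. infsum (g i) places)"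
      unfolding S_def[abs_def] using sum[of "{1..N}"] by (subst infsum_cmult_right) auto
    also have "\<dots> \<le> 1 / (real N - real d) * (\<Sum>i\<in>{1..N}. H)"
      using assms(7,10) height_eq by (intro mult_left_mono sum_mono) auto
    also have "\<dots> = real N / (real N - real d) * H"
      by simp
    finally have S_le: "infsum S places \<le> real N / (real N - real d) * H" .
    have "infsum h places \<le> infsum (\<lambda>v. S v + E v) places"
      using True summable_on_add[OF S E(1)] local[folded S_def] by (rule infsum_mono)
    also have "\<dots> = infsum S places + infsum E places"
      using S E(1) by (rule infsum_add)
    finally show ?thesis
      using S_le E(2) by (simp add: poly_height_eq)
  qed
  then show ?thesis
    by (simp add: C_eq)
qed

end
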